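(* Consider the discrete-time LPV system $x_{k+1}=A(p_k)x_k+B(p_k)u_k$ with affine $A(p)=A_0+\sum_{i=1}^{n_p}p_iA_i$, $B(p)=B_0+\sum_{i=1}^{n_p}p_iB_i$, and a data set $\mathcal{D}$ from it such that $\mathcal{D}_p$ has full row rank $(1+n_p)(n_x+n_u)$. Let $\gamma>0$, $Q\succeq0$, $R\succ0$. Suppose there exist $P\in\mathbb{S}^{n_x}$, $S\in\mathbb{S}^{n_u}$, $\Xi\in\mathbb{S}^{4n_pn_x}$, $F_Q\in\mathbb{R}^{(N_d-1)(1+n_p)\times n_x(1+n_p)}$ with an associated $\mathcal{F}\in\mathbb{R}^{(N_d-1)\times n_x(1+n_p+n_p^2)}$ satisfying $\mathcal{F}[I_{n_x};\,p\otimes I_{n_x};\,p\otimes p\otimes I_{n_x}]=[I_{N_d-1};\,p\otimes I_{N_d-1}]^\top F_Q[I_{n_x};\,p\otimes I_{n_x}]$ for all $p\in\mathbb{P}$, and $\mathcal{Y}=[Y_0\ \bar Y]$ with $Y_0\in\mathbb{R}^{n_u\times n_x}$, $\bar Y\in\mathbb{R}^{n_u\times n_xn_p}$, such that $$\begin{bmatrix}P&0&0\\0&I_{n_p}\otimes P&0\\ Y_0&\bar Y&0\\ 0& I_{n_p}\otimes Y_0& I_{n_p}\otimes\bar Y\end{bmatrix}=\mathcal{D}_p\mathcal{F},$$ $$\begin{bmatrix}S& R^{1/2}\mathcal{Y}\begin{bmatrix}I_{n_x}\\ p\otimes I_{n_x}\end{bmatrix}\\ \left(R^{1/2}\mathcal{Y}\begin{bmatrix}I_{n_x}\\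 p\otimes I_{n_x}\end{bmatrix}\right)^\top & P\end{bmatrix}\succ0,\qquad P-I_{n_x}\succ0,\qquad \mathrm{trace}(QP)+\mathrm{trace}(S)<\gamma^2,$$ for all $p\in\mathbb{P}$, and the full-block LMI conditions (defined in the context) hold for all $p\in\mathbb{P}$ with $\Delta(p)=\mathrm{diag}(p)\otimes I_{2n_x}$, $W=\begin{bmatrix}P_0-I_{n_{x0}}&\mathcal{X}_+F_Q\\ (\mathcal{X}_+F_Q)^\top&P_0\end{bmatrix}$, $I_{n_{x0}}=\mathrm{blkdiag}(I_{n_x},0_{n_xn_p})$, $P_0=\mathrm{blkdiag}(P,0_{n_xn_p})$, $\mathcal{X}_+=\mathrm{blkdiag}(X_+,I_{n_p}\otimes X_+)$, $L_{11}=0_{2n_xn_p}$, $L_{12}=1_{n_p}\otimes I_{2n_x}$, $L_{21}=\begin{bmatrix}0_{n_x\times 2n_xn_p}\\ I_{n_p}\otimes[I_{n_x}\ 0]\\ 0_{n_x\times 2n_xn_p}\\ I_{n_p}\otimes[0\ I_{n_x}]\end{bmatrix}$, $L_{22}=\begin{bmatrix}[I_{n_x}\ 0]\\ 1_{n_p}\otimes 0_{n_x\times 2n_x}\\ [0\ I_{n_x}]\\ 1_{n_p}\otimes 0_{n_x\times 2n_x}\end{bmatrix}$. Then the LPV state-feedback controller $K(p)=K_0+\sum_{i=1}^{n_p}p_iK_i$ with $K_0=Y_0P^{-1}$, $[K_1\ \cdots\ K_{n_p}]=\bar Y(I_{n_p}\otimes P)^{-1}$ stabilizes the system and the closed-loop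 generalized plant $x_{k+1}=(A(p_k)+B(p_k)K(p_k))x_k+w_k$, $z_k=\begin{bmatrix}Q^{1/2}\\ R^{1/2}K(p_k)\end{bmatrix}x_k$ has $\mathcal{H}_2^g$-norm less than $\gamma$.
   Context: Notation: $\otimes$ Kronecker product; $I_n$ identity; $0_{n\times m}$, $0_n$ zero matrices; $1_n$ the all-ones vector; $\mathbb{S}^n$ real symmetric matrices; $\mathrm{blkdiag}$ block-diagonal concatenation; $\mathrm{diag}(p)$ diagonal matrix of entries of $p$; $[a;b]$ vertical stacking. The system has fully measured state $x_k\in\mathbb{R}^{n_x}$, input $u_k\in\mathbb{R}^{n_u}$, scheduling $p_k\in\mathbb{P}\subset\mathbb{R}^{n_p}$, $\mathbb{P}$ compact and convex; $A_i,B_i$ unknown real matrices. $\mathcal{D}=\{u^d_k,p^d_k,x^d_k\}_{k=1}^{N_d}$ is a trajectory of the system; $U=[u^d_1\cdots u^d_{N_d-1}]$, $U^p=[p^d_1\otimes u^d_1\cdots p^d_{N_d-1}\otimes u^d_{N_d-1}]$, $X=[x^d_1\cdots x^d_{N_d-1}]$, $X^p=[p^d_1\otimes x^d_1\cdots p^d_{N_d-1}\otimes x^d_{N_d-1}]$, $X_+=[x^d_2\cdots x^d_{N_d}]$, $\mathcal{D}_p=[X^\top\ (X^p)^\top\ U^\top\ (U^p)^\top]^\top$. Stabilizing means asymptotic stability of $x_{k+1}=(A(p_k)+B(p_k)K(p_k))x_k$ for all scheduling trajectories in $\mathbb{P}$. For an exponentially stable generalized plant $\Sigma$ with disturbance $w$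 and performance output $z$, the $\mathcal{H}_2^g$-norm is $\|\Sigma\|_{\mathcal{H}_2^g}=\big(\limsup_{N\to\infty}\mathbb{E}\{\frac1N\sum_{k=0}^N z_k^\top z_k\}\big)^{1/2}$ when $w$ is a white noise signal, with $\mathbb{E}$ the expectation w.r.t. $w$. Full-block LMI conditions for given $(\Delta(p),W,L_{11},L_{12},L_{21},L_{22})$ and symmetric $\Xi$: $\begin{bmatrix}L_{11}&L_{12}\\ I&0\end{bmatrix}^\top\Xi\begin{bmatrix}L_{11}&L_{12}\\ I&0\end{bmatrix}-\begin{bmatrix}L_{21}&L_{22}\end{bmatrix}^\top W\begin{bmatrix}L_{21}&L_{22}\end{bmatrix}\prec0$ and $\begin{bmatrix}I\\ \Delta(p)\end{bmatrix}^\top\Xi\begin{bmatrix}I\\ \Delta(p)\end{bmatrix}\succeq0$ for all $p\in\mathbb{P}$. *)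

theory Defs
  imports "HOL-Probability.Probability" "Jordan_Normal_Form.Matrix" "Jordan_Normal_Form.DL_Rank"
begin

definition vnorm :: "real Matrix.vec \<Rightarrow> real" where
  "vnorm v = sqrt (v \<bullet> v)"

definition kron :: "real mat \<Rightarrow> real mat \<Rightarrow> real mat" where
  "kron A B = Matrix.mat (dim_row A * dim_row B) (dim_col A * dim_col B)
     (\<lambda>(i,j). A $$ (i div dim_row B, j div dim_col B) * B $$ (i mod dim_row B, j mod dim_col B))"

definition kronv :: "real Matrix.vec \<Rightarrow> real Matrix.vec \<Rightarrow> real Matrix.vec" where
  "kronv a b = Matrix.vec (dim_vec a * dim_vec b)
     (\<lambda>i. a $ (i div dim_vec b) * b $ (i mod dim_vec b))"

definition colv :: "real Matrix.vec \<Rightarrow> real mat" where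
  "colv v = Matrix.mat (dim_vec v) 1 (\<lambda>(i,j). v $ i)"

definition ones :: "nat \<Rightarrow> real mat" where
  "ones n = Matrix.mat n 1 (\<lambda>_. 1)"

definition hcat :: "real mat \<Rightarrow> real mat \<Rightarrow> real mat" where
  "hcat A B = Matrix.mat (dim_row A) (dim_col A + dim_col B)
     (\<lambda>(i,j). if j < dim_col A then A $$ (i,j) else B $$ (i, j - dim_col A))"

definition vcat :: "real mat \<Rightarrow> real mat \<Rightarrow> real mat" where
  "vcat A B = Matrix.mat (dim_row A + dim_row B) (dim_col A)
     (\<lambda>(i,j). if i < dim_row A then A $$ (i,j) else B $$ (i - dim_row A, j))"

definition blkdiag :: "real mat \<Rightarrow> real mat \<Rightarrow> real mat" where
  "blkdiag A B = four_block_mat A (0\<^sub>m (dim_row A) (dim_col B)) (0\<^sub>m (dim_row B) (dim_col A)) B"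

definition colblock :: "real mat \<Rightarrow> nat \<Rightarrow> nat \<Rightarrow> real mat" where
  "colblock M i w = Matrix.mat (dim_row M) w (\<lambda>(r,c). M $$ (r, i * w + c))"

definition mtrace :: "real mat \<Rightarrow> real" where
  "mtrace A = (\<Sum>i<dim_row A. A $$ (i,i))"

definition sym_mat :: "real mat \<Rightarrow> bool" where
  "sym_mat A \<longleftrightarrow> A \<in> carrier_mat (dim_row A) (dim_row A) \<and> transpose_mat A = A"

definition pos_def :: "real mat \<Rightarrow> bool" where
  "pos_def A \<longleftrightarrow> sym_mat A \<and>
     (\<forall>v \<in> carrier_vec (dim_row A). v \<noteq> 0\<^sub>v (dim_row A) \<longrightarrow> v \<bullet> (A *\<^sub>v v) > 0)"

definition pos_semidef :: "real mat \<Rightarrow> bool" where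
  "pos_semidef A \<longleftrightarrow> sym_mat A \<and>
     (\<forall>v \<in> carrier_vec (dim_row A). v \<bullet> (A *\<^sub>v v) \<ge> 0)"

definition neg_def :: "real mat \<Rightarrow> bool" where
  "neg_def A \<longleftrightarrow> pos_def (- A)"

definition msqrt :: "real mat \<Rightarrow> real mat" where
  "msqrt A = (THE B. B \<in> carrier_mat (dim_row A) (dim_row A) \<and> pos_semidef B \<and> B * B = A)"

definition minv :: "real mat \<Rightarrow> real mat" where
  "minv A = (THE B. B \<in> carrier_mat (dim_row A) (dim_row A) \<and>
                    A * B = 1\<^sub>m (dim_row A) \<and> B * A = 1\<^sub>m (dim_row A))"

definition full_row_rank :: "real mat \<Rightarrow> bool" where
  "full_row_rank D \<longleftrightarrow> vec_space.rank (dim_row D) D = dim_row D"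

text \<open>p is 0-indexed in the vector, so p_i is \<open>p $ (i-1)\<close>\<close>
fun aff :: "(nat \<Rightarrow> real mat) \<Rightarrow> nat \<Rightarrow> real Matrix.vec \<Rightarrow> real mat" where
  "aff M 0 p = M 0"
| "aff M (Suc i) p = aff M i p + (p $ i) \<cdot>\<^sub>m M (Suc i)"

definition sched_set :: "nat \<Rightarrow> real Matrix.vec set \<Rightarrow> bool" where
  "sched_set np PP \<longleftrightarrow> PP \<subseteq> carrier_vec np \<and>
     compact ((\<lambda>p i. if i < np then p $ i else 0) ` PP) \<and>
     (\<forall>p\<in>PP. \<forall>q\<in>PP. \<forall>t::real. 0 \<le> t \<and> t \<le> 1 \<longrightarrow> t \<cdot>\<^sub>v p + (1 - t) \<cdot>\<^sub>v q \<in> PP)"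

definition dataU :: "nat \<Rightarrow> nat \<Rightarrow> (nat \<Rightarrow> real Matrix.vec) \<Rightarrow> real mat" where
  "dataU nu Nd ud = mat_of_cols nu (map ud [1..<Nd])"

definition dataUp :: "nat \<Rightarrow> nat \<Rightarrow> nat \<Rightarrow> (nat \<Rightarrow> real Matrix.vec) \<Rightarrow> (nat \<Rightarrow> real Matrix.vec) \<Rightarrow> real mat" where
  "dataUp np nu Nd pd ud = mat_of_cols (np * nu) (map (\<lambda>k. kronv (pd k) (ud k)) [1..<Nd])"

definition dataX :: "nat \<Rightarrow> nat \<Rightarrow> (nat \<Rightarrow> real Matrix.vec) \<Rightarrow> real mat" where
  "dataX nx Nd xd = mat_of_cols nx (map xd [1..<Nd])"

definition dataXp :: "nat \<Rightarrow> nat \<Rightarrow> nat \<Rightarrow> (nat \<Rightarrow> real Matrix.vec) \<Rightarrow> (nat \<Rightarrow> real Matrix.vec) \<Rightarrow> real mat" where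
  "dataXp np nx Nd pd xd = mat_of_cols (np * nx) (map (\<lambda>k. kronv (pd k) (xd k)) [1..<Nd])"

definition dataXplus :: "nat \<Rightarrow> nat \<Rightarrow> (nat \<Rightarrow> real Matrix.vec) \<Rightarrow> real mat" where
  "dataXplus nx Nd xd = mat_of_cols nx (map xd [2..<Nd+1])"

definition dataDp :: "nat \<Rightarrow> nat \<Rightarrow> nat \<Rightarrow> nat \<Rightarrow> (nat \<Rightarrow> real Matrix.vec) \<Rightarrow> (nat \<Rightarrow> real Matrix.vec) \<Rightarrow> (nat \<Rightarrow> real Matrix.vec) \<Rightarrow> real mat" where
  "dataDp nx nu np Nd ud pd xd =
     vcat (dataX nx Nd xd) (vcat (dataXp np nx Nd pd xd) (vcat (dataU nu Nd ud) (dataUp np nu Nd pd ud)))"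

fun ltv_traj :: "(nat \<Rightarrow> real mat) \<Rightarrow> real Matrix.vec \<Rightarrow> nat \<Rightarrow> real Matrix.vec" where
  "ltv_traj Mk x0 0 = x0"
| "ltv_traj Mk x0 (Suc k) = Mk k *\<^sub>v ltv_traj Mk x0 k"

definition asym_stable :: "nat \<Rightarrow> (nat \<Rightarrow> real mat) \<Rightarrow> bool" where
  "asym_stable n Mk \<longleftrightarrow>
     (\<forall>\<epsilon>>0. \<exists>\<delta>>0. \<forall>x0 \<in> carrier_vec n. vnorm x0 < \<delta> \<longrightarrow> (\<forall>k. vnorm (ltv_traj Mk x0 k) < \<epsilon>)) \<and>
     (\<forall>x0 \<in> carrier_vec n. (\<lambda>k. vnorm (ltv_traj Mk x0 k)) \<longlonglongrightarrow> 0)"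

definition lpv_stable :: "nat \<Rightarrow> real Matrix.vec set \<Rightarrow> (real Matrix.vec \<Rightarrow> real mat) \<Rightarrow> bool" where
  "lpv_stable n PP Acl \<longleftrightarrow> (\<forall>ps. (\<forall>k. ps k \<in> PP) \<longrightarrow> asym_stable n (\<lambda>k. Acl (ps k)))"

definition white_noise :: "'w measure \<Rightarrow> nat \<Rightarrow> (nat \<Rightarrow> 'w \<Rightarrow> real Matrix.vec) \<Rightarrow> bool" where
  "white_noise M n w \<longleftrightarrow>
     (\<forall>k. \<forall>\<omega>\<in>space M. w k \<omega> \<in> carrier_vec n) \<and>
     (\<forall>k i. i < n \<longrightarrow> (\<lambda>\<omega>. w k \<omega> $ i) \<in> borel_measurable M \<and>
                       integrable M (\<lambda>\<omega>. (w k \<omega> $ i)\<^sup>2) \<and>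
                       integral\<^sup>L M (\<lambda>\<omega>. w k \<omega> $ i) = 0) \<and>
     (\<forall>k j i l. i < n \<longrightarrow> l < n \<longrightarrow>
        integral\<^sup>L M (\<lambda>\<omega>. w k \<omega> $ i * w j \<omega> $ l) = (if k = j \<and> i = l then 1 else 0))"

fun noisy_traj :: "nat \<Rightarrow> (nat \<Rightarrow> real mat) \<Rightarrow> (nat \<Rightarrow> 'w \<Rightarrow> real Matrix.vec) \<Rightarrow> nat \<Rightarrow> 'w \<Rightarrow> real Matrix.vec" where
  "noisy_traj n Mk w 0 \<omega> = 0\<^sub>v n"
| "noisy_traj n Mk w (Suc k) \<omega> = Mk k *\<^sub>v noisy_traj n Mk w k \<omega> + w k \<omega>"

definition h2g_sq :: "'w measure \<Rightarrow> nat \<Rightarrow> real Matrix.vec set \<Rightarrow> (real Matrix.vec \<Rightarrow> real mat)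
                      \<Rightarrow> (real Matrix.vec \<Rightarrow> real mat) \<Rightarrow> ereal" where
  "h2g_sq M n PP Acl Cz =
     (SUP psw \<in> {(ps, w). (\<forall>k. ps k \<in> PP) \<and> white_noise M n w}.
        limsup (\<lambda>N. ereal (integral\<^sup>L M (\<lambda>\<omega>. (1 / real N) *
           (\<Sum>k\<le>N. let z = Cz (fst psw k) *\<^sub>v noisy_traj n (\<lambda>j. Acl (fst psw j)) (snd psw) k \<omega>
                    in z \<bullet> z)))))"

definition lhs_block :: "nat \<Rightarrow> nat \<Rightarrow> nat \<Rightarrow> real mat \<Rightarrow> real mat \<Rightarrow> real mat \<Rightarrow> real mat" where
  "lhs_block nx nu np P Y0 Ybar =
     vcat (hcat P (hcat (0\<^sub>m nx (nx * np)) (0\<^sub>m nx (nx * np * np))))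
    (vcat (hcat (0\<^sub>m (np * nx) nx) (hcat (kron (1\<^sub>m np) P) (0\<^sub>m (np * nx) (nx * np * np))))
    (vcat (hcat Y0 (hcat Ybar (0\<^sub>m nu (nx * np * np))))
          (hcat (0\<^sub>m (np * nu) nx) (hcat (kron (1\<^sub>m np) Y0) (kron (1\<^sub>m np) Ybar)))))"

definition Delta :: "nat \<Rightarrow> nat \<Rightarrow> real Matrix.vec \<Rightarrow> real mat" where
  "Delta nx np p = kron (mat_diag np (\<lambda>i. p $ i)) (1\<^sub>m (2 * nx))"

definition Wmat :: "nat \<Rightarrow> nat \<Rightarrow> real mat \<Rightarrow> real mat \<Rightarrow> real mat \<Rightarrow> real mat" where
  "Wmat nx np P Xplus FQ =
     (let Inx0 = blkdiag (1\<^sub>m nx) (0\<^sub>m (nx * np) (nx * np));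
          P0 = blkdiag P (0\<^sub>m (nx * np) (nx * np));
          Xc = blkdiag Xplus (kron (1\<^sub>m np) Xplus)
      in four_block_mat (P0 - Inx0) (Xc * FQ) (transpose_mat (Xc * FQ)) P0)"

definition L11 :: "nat \<Rightarrow> nat \<Rightarrow> real mat" where
  "L11 nx np = 0\<^sub>m (2 * nx * np) (2 * nx * np)"

definition L12 :: "nat \<Rightarrow> nat \<Rightarrow> real mat" where
  "L12 nx np = kron (ones np) (1\<^sub>m (2 * nx))"

definition L21 :: "nat \<Rightarrow> nat \<Rightarrow> real mat" where
  "L21 nx np =
     vcat (0\<^sub>m nx (2 * nx * np))
    (vcat (kron (1\<^sub>m np) (hcat (1\<^sub>m nx) (0\<^sub>m nx nx)))
    (vcat (0\<^sub>m nx (2 * nx * np))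
          (kron (1\<^sub>m np) (hcat (0\<^sub>m nx nx) (1\<^sub>m nx)))))"

definition L22 :: "nat \<Rightarrow> nat \<Rightarrow> real mat" where
  "L22 nx np =
     vcat (hcat (1\<^sub>m nx) (0\<^sub>m nx nx))
    (vcat (kron (ones np) (0\<^sub>m nx (2 * nx)))
    (vcat (hcat (0\<^sub>m nx nx) (1\<^sub>m nx))
          (kron (ones np) (0\<^sub>m nx (2 * nx)))))"

definition full_block_lmi :: "real Matrix.vec set \<Rightarrow> (real Matrix.vec \<Rightarrow> real mat) \<Rightarrow> real mat
    \<Rightarrow> real mat \<Rightarrow> real mat \<Rightarrow> real mat \<Rightarrow> real mat \<Rightarrow> real mat \<Rightarrow> bool" where
  "full_block_lmi PP Dl W l11 l12 l21 l22 Xi \<longleftrightarrow>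
     (let T = four_block_mat l11 l12 (1\<^sub>m (dim_col l11)) (0\<^sub>m (dim_col l11) (dim_col l12));
          Bm = hcat l21 l22
      in neg_def (transpose_mat T * Xi * T - transpose_mat Bm * W * Bm)) \<and>
     (\<forall>p\<in>PP. pos_semidef (transpose_mat (vcat (1\<^sub>m (dim_row (Dl p))) (Dl p)) * Xi
                             * vcat (1\<^sub>m (dim_row (Dl p))) (Dl p)))"

end

theory Submission
  imports Defs
begin

text \<open>Sandwiching the full-block condition by \<open>[p \<otimes> I; I]\<close> eliminates the scheduling block
  (the multiplier term is nonnegative along this subspace), and the data equation turns
  \<open>\<X>\<^sub>+ F\<^sub>Q\<close> into the closed loop times \<open>P\<close>. With \<open>A\<^sub>c\<close> the closed-loop matrix, what remains is
  \<open>v\<^sub>1\<^sup>T (P - I) v\<^sub>1 + 2 v\<^sub>1\<^sup>T A\<^sub>c P v\<^sub>2 + v\<^sub>2\<^sup>T P v\<^sub>2 \<ge> 0\<close>, and \<open>v\<^sub>2 = - A\<^sub>c\<^sup>T v\<^sub>1\<close> gives the dual Lyapunov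
  inequality \<open>A\<^sub>c P A\<^sub>c\<^sup>T + I \<le> P\<close>, uniformly in \<open>p\<close>.
  It is applied to linear functionals of the state rather than to the state itself: by induction
  \<open>(v \<bullet> x\<^sub>k)\<^sup>2\<close> decays geometrically without noise, and \<open>E (v \<bullet> x\<^sub>k)\<^sup>2 \<le> v\<^sup>T P v\<close> with noise. Applying the
  latter to the rows of the output matrix bounds the output energy by
  \<open>trace (Q P) + trace (R\<^sup>1\<^sup>/\<^sup>2 K P K\<^sup>T R\<^sup>1\<^sup>/\<^sup>2)\<close>, whose second term is at most \<open>trace S\<close> by the Schur
  complement.\<close>

text \<open>The vector \<open>v\<^sub>2 = - A\<^sub>c\<^sup>T v\<^sub>1\<close> minimises the
  remaining form over \<open>v\<^sub>2\<close>. It contains no inverse because the data equation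
  delivers the product \<open>A\<^sub>c P\<close>, already multiplied by \<open>P\<close> on the
  right. The result bounds \<open>A\<^sub>c P A\<^sub>c\<^sup>T\<close>, whereas a Lyapunov function
  of the state would call for the inverse of \<open>P\<close>. Working with functionals avoids this
  passage: the last factor of a product of closed-loop matrices is transposed onto \<open>v\<close>,
  so the dual inequality is used exactly as it stands, and one fixed \<open>P\<close> serves every
  scheduling sequence. White noise of unit covariance adds \<open>v \<bullet> v\<close> to the
  second moment at each step, which is precisely the identity in that inequality. The weights
  \<open>msqrt Q\<close> and \<open>msqrt R\<close> are definite descriptions and carry no
  information until a positive semidefinite root is known to exist and to be unique. The root is
  obtained from a power series, so that only quadratic forms and norms occur and no
  eigenvalues.\<close>

unbundle no inner_syntax and no vec_syntax

subsection \<open>Kronecker products and block matrices\<close>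

text \<open>The entries of \<open>kron\<close> are addressed by \<open>div\<close> and
  \<open>mod\<close>. Grouping the inner index into blocks of length \<open>d\<close> lets a product
  with Kronecker factors be summed factor by factor.\<close>

lemma sum_div_mod:
  fixes f :: "nat \<Rightarrow> nat \<Rightarrow> 'a::comm_monoid_add"
  shows "(\<Sum>k<m*d. f (k div d) (k mod d)) = (\<Sum>i<m. \<Sum>j<d. f i j)"
proof -
  have "(\<Sum>k<m*d. f (k div d) (k mod d)) = (\<Sum>i<m. \<Sum>k\<in>{i*d..<i*d+d}. f (k div d) (k mod d))"
    by (rule sum.nat_group[symmetric])
  also have "\<dots> = (\<Sum>i<m. \<Sum>j<d. f i j)"
  proof (rule sum.cong[OF refl])
    fix i
    have "(\<Sum>k\<in>{i*d..<i*d+d}. f (k div d) (k mod d)) = (\<Sum>j<d. f ((j + i*d) div d) ((j + i*d) mod d))"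
      using sum.shift_bounds_nat_ivl[of "\<lambda>k. f (k div d) (k mod d)" 0 "i*d" d]
      by (simp add: atLeast0LessThan add.commute)
    also have "\<dots> = (\<Sum>j<d. f i j)" by (rule sum.cong) auto
    finally show "(\<Sum>k\<in>{i*d..<i*d+d}. f (k div d) (k mod d)) = (\<Sum>j<d. f i j)" .
  qed
  finally show ?thesis .
qed

lemma mod_less_of_less_mult: "i < m * d \<Longrightarrow> i mod d < (d::nat)"
  by (metis mod_less_divisor mult_0_right not_less0 neq0_conv)

lemmas div_mod_less = less_mult_imp_div_less mod_less_of_less_mult

lemma kron_dim [simp]: "dim_row (kron A B) = dim_row A * dim_row B" "dim_col (kron A B) = dim_col A * dim_col B"
  by (auto simp: kron_def)

lemma hcat_dim [simp]: "dim_row (hcat A B) = dim_row A" "dim_col (hcat A B) = dim_col A + dim_col B"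
  by (auto simp: hcat_def)

lemma vcat_dim [simp]: "dim_row (vcat A B) = dim_row A + dim_row B" "dim_col (vcat A B) = dim_col A"
  by (auto simp: vcat_def)

lemma blkdiag_dim [simp]: "dim_row (blkdiag A B) = dim_row A + dim_row B" "dim_col (blkdiag A B) = dim_col A + dim_col B"
  by (auto simp: blkdiag_def)

lemma colv_dim [simp]: "dim_row (colv p) = dim_vec p" "dim_col (colv p) = 1"
  by (auto simp: colv_def)

lemma ones_dim [simp]: "dim_row (ones n) = n" "dim_col (ones n) = 1"
  by (auto simp: ones_def)

lemma colblock_dim [simp]: "dim_row (colblock M i n) = dim_row M" "dim_col (colblock M i n) = n"
  by (auto simp: colblock_def)

lemma index_mult_mat_sum:
  assumes "i < dim_row A" "j < dim_col B" "dim_col A = dim_row B"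
  shows "(A * B) $$ (i,j) = (\<Sum>k<dim_col A. A $$ (i,k) * B $$ (k,j))"
  using assms by (simp add: scalar_prod_def atLeast0LessThan)

lemma index_mult_mat_carrier:
  assumes "A \<in> carrier_mat r n" "B \<in> carrier_mat n c" "i < r" "j < c"
  shows "(A * B) $$ (i,j) = (\<Sum>k<n. A $$ (i,k) * B $$ (k,j))"
  using assms by (subst index_mult_mat_sum) auto

text \<open>The mixed-product rule: each summand of the inner product separates into a term in the
  block number and a term in the position within the block, so the double sum factors. Most later
  manipulations of \<open>p \<otimes> I\<close> rest on it.\<close>

lemma kron_mult:
  assumes "dim_col A = dim_row C" "dim_col B = dim_row D"
  shows "kron A B * kron C D = kron (A * C) (B * D)"
proof (rule eq_matI)
  fix i j assume ij: "i < dim_row (kron (A * C) (B * D))" "j < dim_col (kron (A * C) (B * D))"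
  let ?i = "i div dim_row B" and ?i' = "i mod dim_row B"
  let ?j = "j div dim_col D" and ?j' = "j mod dim_col D"
  have l: "?i < dim_row A" "?i' < dim_row B" "?j < dim_col C" "?j' < dim_col D"
    using ij by (simp_all add: div_mod_less)
  have "(kron A B * kron C D) $$ (i,j)
      = (\<Sum>k<dim_col A * dim_col B. kron A B $$ (i,k) * kron C D $$ (k,j))"
    using ij assms by (subst index_mult_mat_sum) auto
  also have "\<dots> = (\<Sum>k<dim_col A * dim_col B.
      (A $$ (?i, k div dim_col B) * B $$ (?i', k mod dim_col B)) *
      (C $$ (k div dim_col B, ?j) * D $$ (k mod dim_col B, ?j')))"
    using ij assms by (intro sum.cong) (auto simp: kron_def)
  also have "\<dots> = (\<Sum>k<dim_col A. \<Sum>l<dim_col B. (A $$ (?i, k) * B $$ (?i', l)) * (C $$ (k, ?j) * D $$ (l, ?j')))"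
    by (rule sum_div_mod)
  also have "\<dots> = (\<Sum>k<dim_col A. A $$ (?i, k) * C $$ (k, ?j)) * (\<Sum>l<dim_col B. B $$ (?i', l) * D $$ (l, ?j'))"
    by (simp add: sum_product mult_ac)
  also have "\<dots> = (A * C) $$ (?i, ?j) * (B * D) $$ (?i', ?j')"
    using l assms by (simp add: index_mult_mat_sum del: index_mult_mat)
  also have "\<dots> = kron (A * C) (B * D) $$ (i,j)"
    using ij by (simp add: kron_def)
  finally show "(kron A B * kron C D) $$ (i,j) = kron (A * C) (B * D) $$ (i,j)" .
qed auto

lemma kron_one: "kron (1\<^sub>m m) (1\<^sub>m n) = 1\<^sub>m (m * n)"
proof (rule eq_matI)
  fix i j assume "i < dim_row (1\<^sub>m (m * n) :: real mat)" "j < dim_col (1\<^sub>m (m * n) :: real mat)"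
  moreover from this have "i div n < m" "j div n < m" "i mod n < n" "j mod n < n"
    by (simp_all add: div_mod_less)
  moreover have "i = j" if "i div n = j div n" "i mod n = j mod n"
    using that by (metis div_mult_mod_eq)
  ultimately show "kron (1\<^sub>m m) (1\<^sub>m n) $$ (i,j) = 1\<^sub>m (m * n) $$ (i,j)"
    by (auto simp: kron_def)
qed auto

lemma kron_transpose: "transpose_mat (kron A B) = kron (transpose_mat A) (transpose_mat B)"
  by (rule eq_matI) (auto simp: kron_def div_mod_less)

lemma kron_zero_right: "kron A (0\<^sub>m r c) = 0\<^sub>m (dim_row A * r) (dim_col A * c)"
  by (rule eq_matI) (auto simp: kron_def div_mod_less)

lemma kron_add_right:
  assumes "dim_row B = dim_row C" "dim_col B = dim_col C"
  shows "kron A (B + C) = kron A B + kron A C"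
  using assms by (intro eq_matI) (auto simp: kron_def div_mod_less algebra_simps)

lemma sum_lessThan_add:
  fixes f :: "nat \<Rightarrow> 'a::comm_monoid_add"
  shows "(\<Sum>k<m + n. f k) = (\<Sum>k<m. f k) + (\<Sum>k<n. f (m + k))"
  by (induction n) (auto simp: add_ac)

lemma hcat_mult_vcat:
  assumes "dim_col A = dim_row C" "dim_col B = dim_row D" "dim_row A = dim_row B" "dim_col C = dim_col D"
  shows "hcat A B * vcat C D = A * C + B * D"
proof (rule eq_matI)
  fix i j assume ij: "i < dim_row (A * C + B * D)" "j < dim_col (A * C + B * D)"
  have "(hcat A B * vcat C D) $$ (i,j) = (\<Sum>k<dim_col A + dim_col B. hcat A B $$ (i,k) * vcat C D $$ (k,j))"
    using ij assms by (subst index_mult_mat_sum) auto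
  also have "\<dots> = (\<Sum>k<dim_col A. hcat A B $$ (i,k) * vcat C D $$ (k,j)) +
      (\<Sum>k<dim_col B. hcat A B $$ (i,dim_col A + k) * vcat C D $$ (dim_col A + k,j))"
    by (rule sum_lessThan_add)
  also have "\<dots> = (\<Sum>k<dim_col A. A $$ (i,k) * C $$ (k,j)) + (\<Sum>k<dim_col B. B $$ (i,k) * D $$ (k,j))"
    using ij assms by (auto simp: hcat_def vcat_def intro!: sum.cong arg_cong2[of _ _ _ _ "(+)"])
  also have "\<dots> = (A * C + B * D) $$ (i,j)"
    using ij assms by (simp add: index_mult_mat_sum del: index_mult_mat(1))
  finally show "(hcat A B * vcat C D) $$ (i,j) = (A * C + B * D) $$ (i,j)" .
qed (use assms in auto)

lemma row_vcat:
  assumes "dim_col A = dim_col B" "i < dim_row A + dim_row B"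
  shows "row (vcat A B) i = (if i < dim_row A then row A i else row B (i - dim_row A))"
  using assms by (intro eq_vecI) (auto simp: vcat_def)

lemma vcat_mult:
  assumes "dim_col A = dim_col B"
  shows "vcat A B * C = vcat (A * C) (B * C)"
proof (rule eq_matI)
  fix i j assume "i < dim_row (vcat (A * C) (B * C))" "j < dim_col (vcat (A * C) (B * C))"
  with row_vcat[OF assms, of i] show "(vcat A B * C) $$ (i,j) = vcat (A * C) (B * C) $$ (i,j)"
    by (auto simp: vcat_def)
qed auto

lemma transpose_vcat:
  assumes "dim_col A = dim_col B"
  shows "transpose_mat (vcat A B) = hcat (transpose_mat A) (transpose_mat B)"
  using assms by (intro eq_matI) (auto simp: vcat_def hcat_def)

lemma vcat_add:
  assumes "dim_row A = dim_row C" "dim_row B = dim_row D" "dim_col A = dim_col C" "dim_col B = dim_col D" "dim_col A = dim_col B"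
  shows "vcat A B + vcat C D = vcat (A + C) (B + D)"
  using assms by (intro eq_matI) (auto simp: vcat_def)

lemma blkdiag_eq: "blkdiag A B = vcat (hcat A (0\<^sub>m (dim_row A) (dim_col B))) (hcat (0\<^sub>m (dim_row B) (dim_col A)) B)"
  by (intro eq_matI) (auto simp: blkdiag_def vcat_def hcat_def)

lemma four_block_eq:
  assumes "dim_row A = dim_row B" "dim_row C = dim_row D" "dim_col A = dim_col C" "dim_col B = dim_col D"
  shows "four_block_mat A B C D = vcat (hcat A B) (hcat C D)"
  using assms by (intro eq_matI) (auto simp: vcat_def hcat_def)

text \<open>The number \<open>m\<close> of terms is kept apart from \<open>np\<close>, so that the
  induction can follow the recursion of \<open>aff\<close> while \<open>M\<close> retains all its
  blocks.\<close>

lemma colblock_affine: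
  assumes "dim_vec p = np" "dim_row M0 = dim_row M" "dim_col M0 = n" "dim_col M = np * n" "m \<le> np"
  shows "aff (\<lambda>i. if i = 0 then M0 else colblock M (i - 1) n) m p =
    Matrix.mat (dim_row M) n (\<lambda>(r,c). M0 $$ (r,c) + (\<Sum>i<m. p $ i * M $$ (r, i * n + c)))"
  using assms(5)
proof (induction m)
  case 0
  then show ?case using assms by (intro eq_matI) auto
next
  case (Suc m)
  show ?case using Suc assms by (intro eq_matI) (auto simp: colblock_def)
qed

lemma mult_kron_colv:
  assumes "dim_vec p = np" "dim_col M = np * n"
  shows "M * kron (colv p) (1\<^sub>m n) = Matrix.mat (dim_row M) n (\<lambda>(r,c). \<Sum>i<np. p $ i * M $$ (r, i * n + c))"
proof (rule eq_matI)
  fix r c assume rc: "r < dim_row (Matrix.mat (dim_row M) n (\<lambda>(r,c). \<Sum>i<np. p $ i * M $$ (r, i * n + c)))"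
     "c < dim_col (Matrix.mat (dim_row M) n (\<lambda>(r,c). \<Sum>i<np. p $ i * M $$ (r, i * n + c)))"
  have "(M * kron (colv p) (1\<^sub>m n)) $$ (r,c) = (\<Sum>k<np*n. M $$ (r,k) * kron (colv p) (1\<^sub>m n) $$ (k,c))"
    using rc assms by (subst index_mult_mat_sum) auto
  \<comment> \<open>The column index of \<open>M\<close> is rewritten through quotient and remainder
    too, because \<open>sum_div_mod\<close> applies only to summands that see \<open>k\<close> in
    this way.\<close>
  also have "\<dots> = (\<Sum>k<np*n. M $$ (r, (k div n) * n + k mod n) * (p $ (k div n) * (if k mod n = c then 1 else 0)))"
    using rc assms by (intro sum.cong) (auto simp: kron_def colv_def div_mod_less)
  also have "\<dots> = (\<Sum>i<np. \<Sum>j<n. M $$ (r, i * n + j) * (p $ i * (if j = c then 1 else 0)))"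
    by (rule sum_div_mod)
  also have "\<dots> = (\<Sum>i<np. p $ i * M $$ (r, i * n + c))"
    using rc by (intro sum.cong) (auto simp: if_distrib mult_ac sum.delta cong: if_cong)
  finally show "(M * kron (colv p) (1\<^sub>m n)) $$ (r,c) =
     Matrix.mat (dim_row M) n (\<lambda>(r,c). \<Sum>i<np. p $ i * M $$ (r, i * n + c)) $$ (r,c)"
    using rc by simp
qed (use assms in auto)

lemma aff_colblock:
  assumes "dim_vec p = np" "dim_row M0 = dim_row M" "dim_col M0 = n" "dim_col M = np * n"
  shows "aff (\<lambda>i. if i = 0 then M0 else colblock M (i - 1) n) np p = M0 + M * kron (colv p) (1\<^sub>m n)"
  using assms by (simp add: colblock_affine mult_kron_colv, intro eq_matI) auto

lemma aff_cong:
  assumes "\<And>i. i \<le> m \<Longrightarrow> M i = N i"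
  shows "aff M m p = aff N m p"
  using assms by (induction m) auto

text \<open>The row of blocks \<open>M 1\<close>, ..., \<open>M m\<close>. The constant term
  \<open>M 0\<close> stays outside, since it is not multiplied by a scheduling variable; hence the
  \<open>Suc\<close>.\<close>

definition hblocks :: "(nat \<Rightarrow> real mat) \<Rightarrow> nat \<Rightarrow> nat \<Rightarrow> nat \<Rightarrow> real mat" where
  "hblocks M r m n = Matrix.mat r (m * n) (\<lambda>(i,j). M (Suc (j div n)) $$ (i, j mod n))"

lemma hblocks_dim [simp]: "dim_row (hblocks M r m n) = r" "dim_col (hblocks M r m n) = m * n"
  by (auto simp: hblocks_def)

lemma aff_hblocks:
  assumes "\<forall>i\<le>np. M i \<in> carrier_mat r n" "dim_vec p = np"
  shows "aff M np p = M 0 + hblocks M r np n * kron (colv p) (1\<^sub>m n)"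
proof -
  have "aff M np p = aff (\<lambda>i. if i = 0 then M 0 else colblock (hblocks M r np n) (i - 1) n) np p"
  proof (rule aff_cong)
    fix i assume "i \<le> np"
    \<comment> \<open>The entries read by \<open>colblock\<close> must lie inside the matrix, as
      values beyond its dimensions are unspecified.\<close>
    moreover have "k * n + c < np * n" if "k < np" "c < n" for k c
    proof -
      have "k * n + c < Suc k * n" using that by simp
      also have "\<dots> \<le> np * n" using that by (intro mult_le_mono1) simp
      finally show ?thesis .
    qed
    ultimately show "M i = (if i = 0 then M 0 else colblock (hblocks M r np n) (i - 1) n)"
      using assms by (auto simp: colblock_def hblocks_def intro!: eq_matI)
  qed
  also have "\<dots> = M 0 + hblocks M r np n * kron (colv p) (1\<^sub>m n)"
    using assms by (intro aff_colblock) auto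
  finally show ?thesis .
qed

subsection \<open>Quadratic forms\<close>

lemma scalar_prod_self_sum: "v \<bullet> v = (\<Sum>i<dim_vec v. (v $ i)\<^sup>2)" for v :: "real Matrix.vec"
  by (simp add: scalar_prod_def atLeast0LessThan power2_eq_square)

lemma scalar_prod_self_nonneg [simp]: "0 \<le> v \<bullet> v" for v :: "real Matrix.vec"
  by (simp add: scalar_prod_self_sum sum_nonneg)

lemma scalar_prod_self_eq_0: "v \<in> carrier_vec n \<Longrightarrow> v \<bullet> v = 0 \<longleftrightarrow> v = 0\<^sub>v n" for v :: "real Matrix.vec"
  by (auto simp: scalar_prod_self_sum sum_nonneg_eq_0_iff)

lemma scalar_prod_Cauchy_Schwarz:
  fixes v w :: "real Matrix.vec"
  assumes "dim_vec v = dim_vec w"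
  shows "(v \<bullet> w)\<^sup>2 \<le> (v \<bullet> v) * (w \<bullet> w)"
  using Cauchy_Schwarz_ineq_sum[of "\<lambda>i. v $ i" "\<lambda>i. w $ i" "{..<dim_vec w}"] assms
  by (simp add: scalar_prod_self_sum) (simp add: scalar_prod_def atLeast0LessThan)

lemma adjoint_scalar_prod:
  fixes A :: "real mat"
  assumes "A \<in> carrier_mat r c" "v \<in> carrier_vec r" "w \<in> carrier_vec c"
  shows "v \<bullet> (A *\<^sub>v w) = (transpose_mat A *\<^sub>v v) \<bullet> w"
  using transpose_vec_mult_scalar[OF assms(1,3,2)] by simp

lemma sym_mat_scalar_prod:
  assumes "sym_mat A" "A \<in> carrier_mat n n" "v \<in> carrier_vec n" "w \<in> carrier_vec n"
  shows "v \<bullet> (A *\<^sub>v w) = (A *\<^sub>v v) \<bullet> w"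
  using adjoint_scalar_prod[OF assms(2-4)] assms(1) by (simp add: sym_mat_def)

text \<open>The sum of the absolute entries is a crude substitute for the largest eigenvalue. Adding
  1 makes \<open>L\<close> a safe divisor and keeps \<open>1 - 1 / L\<close> in the range from 0 to
  1, as the decay rate requires.\<close>

lemma quad_form_bound:
  fixes A :: "real mat"
  assumes "A \<in> carrier_mat n n"
  obtains L where "L \<ge> 1" "\<And>v. v \<in> carrier_vec n \<Longrightarrow> v \<bullet> (A *\<^sub>v v) \<le> L * (v \<bullet> v)"
proof
  let ?L = "1 + (\<Sum>i<n. \<Sum>j<n. \<bar>A $$ (i,j)\<bar>)"
  show "?L \<ge> 1" by (simp add: sum_nonneg)
  fix v :: "real Matrix.vec" assume v: "v \<in> carrier_vec n"
  have entry: "(v $ i)\<^sup>2 \<le> v \<bullet> v" if "i < n" for i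
    using v that by (auto simp: scalar_prod_self_sum intro!: member_le_sum)
  have "v \<bullet> (A *\<^sub>v v) = (\<Sum>i<n. v $ i * (\<Sum>j<n. A $$ (i,j) * v $ j))"
    using assms v by (auto simp: scalar_prod_def atLeast0LessThan)
  also have "\<dots> = (\<Sum>i<n. \<Sum>j<n. A $$ (i,j) * (v $ i * v $ j))"
    by (simp add: sum_distrib_left mult_ac)
  also have "\<dots> \<le> (\<Sum>i<n. \<Sum>j<n. \<bar>A $$ (i,j)\<bar> * (v \<bullet> v))"
  proof (intro sum_mono)
    fix i j assume ij: "i \<in> {..<n}" "j \<in> {..<n}"
    have "2 * \<bar>v $ i * v $ j\<bar> \<le> (v $ i)\<^sup>2 + (v $ j)\<^sup>2"
      using sum_squares_bound[of "\<bar>v $ i\<bar>" "\<bar>v $ j\<bar>"] by (simp add: abs_mult)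
    with ij entry have "\<bar>v $ i * v $ j\<bar> \<le> v \<bullet> v" by (smt (verit) lessThan_iff)
    hence "\<bar>A $$ (i,j)\<bar> * \<bar>v $ i * v $ j\<bar> \<le> \<bar>A $$ (i,j)\<bar> * (v \<bullet> v)"
      by (intro mult_left_mono) auto
    thus "A $$ (i,j) * (v $ i * v $ j) \<le> \<bar>A $$ (i,j)\<bar> * (v \<bullet> v)"
      by (metis abs_ge_self abs_mult order_trans)
  qed
  also have "\<dots> = (\<Sum>i<n. \<Sum>j<n. \<bar>A $$ (i,j)\<bar>) * (v \<bullet> v)" by (simp add: sum_distrib_right)
  also have "\<dots> \<le> ?L * (v \<bullet> v)" by (simp add: distrib_right)
  finally show "v \<bullet> (A *\<^sub>v v) \<le> ?L * (v \<bullet> v)" .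
qed

lemma quad_form_add_smult:
  fixes A :: "real mat"
  assumes A: "A \<in> carrier_mat n n" "sym_mat A" and vw: "v \<in> carrier_vec n" "w \<in> carrier_vec n"
  shows "(v + s \<cdot>\<^sub>v w) \<bullet> (A *\<^sub>v (v + s \<cdot>\<^sub>v w)) =
    v \<bullet> (A *\<^sub>v v) + 2 * s * (v \<bullet> (A *\<^sub>v w)) + s\<^sup>2 * (w \<bullet> (A *\<^sub>v w))"
proof -
  have c: "A *\<^sub>v v \<in> carrier_vec n" "A *\<^sub>v w \<in> carrier_vec n" using A vw by auto
  have "A *\<^sub>v (v + s \<cdot>\<^sub>v w) = A *\<^sub>v v + s \<cdot>\<^sub>v (A *\<^sub>v w)"
    using A vw by (simp add: mult_add_distrib_mat_vec mult_mat_vec)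
  moreover have "w \<bullet> (A *\<^sub>v v) = v \<bullet> (A *\<^sub>v w)"
    using sym_mat_scalar_prod[OF A(2,1) vw(2,1)] comm_scalar_prod[OF c(2) vw(1)] by simp
  ultimately show ?thesis using A vw c
    by (simp add: scalar_prod_add_distrib[of _ n] add_scalar_prod_distrib[of _ n] power2_eq_square
        algebra_simps)
qed

text \<open>This is \<open>A\<^sup>2 \<le> L A\<close> for \<open>0 \<le> A \<le> L\<close>, proved
  without eigenvalues: the form of \<open>A\<close> is nonnegative at
  \<open>v - (1 / L) A v\<close>. The coefficient \<open>- 1 / L\<close> minimises the upper bound
  obtained by estimating the quadratic term with \<open>L\<close>.\<close>

lemma pos_semidef_norm_mult_le:
  assumes A: "A \<in> carrier_mat n n" "pos_semidef A" and L: "L > 0"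
    and bound: "\<And>v. v \<in> carrier_vec n \<Longrightarrow> v \<bullet> (A *\<^sub>v v) \<le> L * (v \<bullet> v)"
    and v: "v \<in> carrier_vec n"
  shows "(A *\<^sub>v v) \<bullet> (A *\<^sub>v v) \<le> L * (v \<bullet> (A *\<^sub>v v))"
proof -
  let ?w = "A *\<^sub>v v" and ?s = "- (1 / L)"
  have S: "sym_mat A" and c: "?w \<in> carrier_vec n" using A v by (auto simp: pos_semidef_def)
  have "v + ?s \<cdot>\<^sub>v ?w \<in> carrier_vec n" using v c by auto
  hence "0 \<le> (v + ?s \<cdot>\<^sub>v ?w) \<bullet> (A *\<^sub>v (v + ?s \<cdot>\<^sub>v ?w))"
    using A by (auto simp: pos_semidef_def)
  also have "\<dots> = v \<bullet> ?w + 2 * ?s * (?w \<bullet> ?w) + ?s\<^sup>2 * (?w \<bullet> (A *\<^sub>v ?w))"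
    using quad_form_add_smult[OF A(1) S v c] sym_mat_scalar_prod[OF S A(1) v c] by simp
  also have "\<dots> \<le> v \<bullet> ?w + 2 * ?s * (?w \<bullet> ?w) + ?s\<^sup>2 * (L * (?w \<bullet> ?w))"
    using bound[OF c] by (simp add: mult_left_mono)
  also have "\<dots> = v \<bullet> ?w - (?w \<bullet> ?w) / L"
    using L by (simp add: field_simps power2_eq_square)
  finally show ?thesis using L by (simp add: field_simps)
qed

subsection \<open>Square roots of positive semidefinite matrices\<close>

text \<open>Taylor coefficients of \<open>sqrt (1 - x)\<close> at 0; their partial sums are nonnegative, which gives
  absolute convergence up to \<open>x = 1\<close>.\<close>

definition sqrt_coeff :: "nat \<Rightarrow> real" where
  "sqrt_coeff k = (1/2 gchoose k) * (-1) ^ k"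

lemma sqrt_coeff_0 [simp]: "sqrt_coeff 0 = 1"
  by (simp add: sqrt_coeff_def)

text \<open>Negating the upper index absorbs the sign and leaves a product of the factors
  \<open>k - 3/2 - i\<close>. All of them are positive except the last one,
  \<open>i = k - 1\<close>, which equals \<open>- 1/2\<close>.\<close>

lemma sqrt_coeff_nonpos: "k > 0 \<Longrightarrow> sqrt_coeff k \<le> 0"
proof -
  assume "k > 0"
  then obtain m where k: "k = Suc m" by (cases k) auto
  have "(\<Prod>i=0..<m. of_nat k - 3/2 - of_nat i :: real) \<ge> 0"
  proof (rule prod_nonneg)
    fix i assume "i \<in> {0..<m}"
    hence "real i + 1 \<le> real m" by simp
    thus "0 \<le> (of_nat k - 3/2 - of_nat i :: real)" by (simp add: k)
  qed
  hence "(\<Prod>i=0..<k. of_nat k - 3/2 - of_nat i :: real) \<le> 0"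
    by (simp add: k mult_nonneg_nonpos)
  moreover have "sqrt_coeff k = (of_nat k - 1/2 - 1 gchoose k)"
    by (subst gbinomial_negated_upper) (simp add: sqrt_coeff_def flip: power_mult_distrib)
  hence "sqrt_coeff k = (\<Prod>i=0..<k. of_nat k - 3/2 - of_nat i) / fact k"
    by (simp add: gbinomial_prod_rev)
  ultimately show ?thesis by (simp add: divide_nonpos_pos)
qed

text \<open>An alternating partial sum of binomial coefficients is again a signed binomial
  coefficient, with upper index lowered to \<open>- 1/2\<close>. After negating that index every
  factor \<open>n - 1/2 - i\<close> is at least \<open>1/2\<close>.\<close>

lemma sqrt_coeff_sum_nonneg: "0 \<le> (\<Sum>k\<le>n. sqrt_coeff k)"
proof -
  have "(\<Sum>k\<le>n. sqrt_coeff k) = (-1) ^ n * (1/2 - 1 gchoose n)"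
    unfolding sqrt_coeff_def by (rule gbinomial_sum_lower_neg)
  also have "\<dots> = (of_nat n - 1/2 gchoose n)"
    by (subst (2) gbinomial_negated_upper) (simp add: mult_ac)
  also have "\<dots> = (\<Prod>i=0..<n. of_nat n - 1/2 - of_nat i) / fact n"
    by (simp add: gbinomial_prod_rev)
  also have "\<dots> \<ge> 0"
  proof (intro divide_nonneg_nonneg prod_nonneg)
    fix i assume "i \<in> {0..<n}"
    hence "real i + 1 \<le> real n" by simp
    thus "0 \<le> (of_nat n - 1/2 - of_nat i :: real)" by simp
  qed auto
  finally show ?thesis .
qed

lemma sqrt_coeff_summable: "summable (\<lambda>k. \<bar>sqrt_coeff k\<bar>)"
proof (rule summableI_nonneg_bounded)
  fix n
  \<comment> \<open>Only the zeroth coefficient, equal to 1, is positive. Taking absolute values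
    therefore flips the sign of everything else.\<close>
  have "(\<Sum>k\<le>n. \<bar>sqrt_coeff k\<bar>) = 2 - (\<Sum>k\<le>n. sqrt_coeff k)"
  proof (induction n)
    case (Suc n)
    thus ?case using sqrt_coeff_nonpos[of "Suc n"] by simp
  qed simp
  hence "(\<Sum>k\<le>n. \<bar>sqrt_coeff k\<bar>) \<le> 2" using sqrt_coeff_sum_nonneg[of n] by simp
  moreover have "(\<Sum>k<n. \<bar>sqrt_coeff k\<bar>) \<le> (\<Sum>k\<le>n. \<bar>sqrt_coeff k\<bar>)"
    by (intro sum_mono2) auto
  ultimately show "(\<Sum>k<n. \<bar>sqrt_coeff k\<bar>) \<le> 2" by linarith
qed simp

text \<open>The square of the series of \<open>sqrt (1 - x)\<close> is \<open>1 - x\<close>. On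
  coefficients this is the Vandermonde identity with \<open>1/2 + 1/2 = 1\<close>.\<close>

lemma sqrt_coeff_convolution:
  "(\<Sum>k\<le>n. sqrt_coeff k * sqrt_coeff (n - k)) = (if n = 0 then 1 else if n = 1 then -1 else 0)"
proof -
  have "(\<Sum>k\<le>n. sqrt_coeff k * sqrt_coeff (n - k)) =
      (\<Sum>k\<in>{0..n}. (-1) ^ n * ((1/2 gchoose k) * (1/2 gchoose (n - k))))"
    unfolding atLeast0AtMost
  proof (rule sum.cong[OF refl])
    fix k assume "k \<in> {..n}"
    hence "(-1::real) ^ n = (-1) ^ k * (-1) ^ (n - k)" by (simp flip: power_add)
    thus "sqrt_coeff k * sqrt_coeff (n - k) = (-1) ^ n * ((1/2 gchoose k) * (1/2 gchoose (n - k)))"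
      by (simp add: sqrt_coeff_def)
  qed
  also have "\<dots> = (-1) ^ n * ((1/2 + 1/2) gchoose n)"
    by (simp only: sum_distrib_left[symmetric] gbinomial_Vandermonde)
  also have "\<dots> = (-1) ^ n * (of_nat 1 gchoose n)" by simp
  also have "\<dots> = (-1) ^ n * real (1 choose n)" by (subst binomial_gbinomial) simp
  also have "\<dots> = (if n = 0 then 1 else if n = 1 then -1 else 0)"
    by (auto simp: binomial_eq_0)
  finally show ?thesis .
qed

section \<open>Matrix powers, and equality of matrices tested on vectors\<close>

lemma pow_mat_add:
  assumes "A \<in> carrier_mat n n"
  shows "A ^\<^sub>m (k + l) = A ^\<^sub>m k * A ^\<^sub>m l"
proof (induction l)
  case (Suc l)
  show ?case using assms Suc assoc_mult_mat[of "A ^\<^sub>m k" n n "A ^\<^sub>m l" n A n] by simp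
qed (use assms in simp)

lemma pow_mat_commute:
  assumes "A \<in> carrier_mat n n" "C \<in> carrier_mat n n" "C * A = A * C"
  shows "C * A ^\<^sub>m k = A ^\<^sub>m k * C"
proof (induction k)
  case (Suc k)
  have c: "A ^\<^sub>m k \<in> carrier_mat n n" using assms by simp
  have "C * A ^\<^sub>m Suc k = (C * A ^\<^sub>m k) * A"
    using assoc_mult_mat[OF assms(2) c assms(1)] by simp
  also have "\<dots> = A ^\<^sub>m k * (C * A)"
    unfolding Suc by (rule assoc_mult_mat[OF c assms(2,1)])
  also have "\<dots> = A ^\<^sub>m Suc k * C"
    unfolding assms(3) using assoc_mult_mat[OF c assms(1,2)] by simp
  finally show ?case .
qed (use assms in simp)

lemma transpose_pow_mat:
  fixes A :: "real mat"
  assumes "A \<in> carrier_mat n n" "transpose_mat A = A"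
  shows "transpose_mat (A ^\<^sub>m k) = A ^\<^sub>m k"
proof (induction k)
  case (Suc k)
  have "transpose_mat (A ^\<^sub>m Suc k) = A * A ^\<^sub>m k"
    using assms Suc transpose_mult[of "A ^\<^sub>m k" n n A n] by simp
  thus ?case using pow_mat_commute[OF assms(1) assms(1) refl, of k] by simp
qed (use assms in simp)

lemma mult_mat_unit_vec:
  fixes A :: "real mat"
  assumes "A \<in> carrier_mat r c" "i < r" "j < c"
  shows "(A *\<^sub>v unit_vec c j) $ i = A $$ (i,j)"
  using assms by auto

lemma mat_eq_mult_vec:
  fixes A :: "real mat"
  assumes "A \<in> carrier_mat r c" "B \<in> carrier_mat r c"
    "\<And>v. v \<in> carrier_vec c \<Longrightarrow> A *\<^sub>v v = B *\<^sub>v v"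
  shows "A = B"
proof (rule eq_matI)
  fix i j assume "i < dim_row B" "j < dim_col B"
  thus "A $$ (i,j) = B $$ (i,j)"
    using assms mult_mat_unit_vec[of A r c i j] mult_mat_unit_vec[of B r c i j] by auto
qed (use assms in auto)

lemma vec_eq_if_diff_0:
  fixes v :: "real Matrix.vec"
  assumes "v \<in> carrier_vec n" "w \<in> carrier_vec n" "v - w = 0\<^sub>v n"
  shows "v = w"
proof (rule eq_vecI)
  fix i assume i: "i < dim_vec w"
  hence "v $ i - w $ i = (v - w) $ i" by simp
  also have "\<dots> = 0" using i assms(2) unfolding assms(3) by simp
  finally show "v $ i = w $ i" by simp
qed (use assms in auto)

text \<open>The root is the power series of \<open>sqrt (1 - x)\<close> in \<open>B\<close>, hence commutes with whatever commutes
  with \<open>B\<close>; this is what makes the root unique.\<close>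

lemma contraction_sqrt_ex:
  fixes B :: "real mat"
  assumes B: "B \<in> carrier_mat n n" "transpose_mat B = B"
    and contr: "\<And>v. v \<in> carrier_vec n \<Longrightarrow> (B *\<^sub>v v) \<bullet> (B *\<^sub>v v) \<le> v \<bullet> v"
  obtains S where "S \<in> carrier_mat n n" "pos_semidef S" "S * S = 1\<^sub>m n - B"
    "\<And>C. C \<in> carrier_mat n n \<Longrightarrow> C * B = B * C \<Longrightarrow> C * S = S * C"
proof
  have Bk: "B ^\<^sub>m k \<in> carrier_mat n n" for k using B by simp
  have Bk_contr: "(B ^\<^sub>m k *\<^sub>v v) \<bullet> (B ^\<^sub>m k *\<^sub>v v) \<le> v \<bullet> v" if "v \<in> carrier_vec n" for k v
    using that
  proof (induction k arbitrary: v)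
    case (Suc k)
    have "B ^\<^sub>m Suc k *\<^sub>v v = B ^\<^sub>m k *\<^sub>v (B *\<^sub>v v)"
      using assoc_mult_mat_vec[OF Bk B(1) Suc.prems] by simp
    thus ?case using Suc.IH[of "B *\<^sub>v v"] contr[OF Suc.prems] Suc.prems B by fastforce
  qed (use B in auto)
  have Bk_form: "\<bar>v \<bullet> (B ^\<^sub>m k *\<^sub>v w)\<bar> \<le> sqrt ((v \<bullet> v) * (w \<bullet> w))"
    if vw: "v \<in> carrier_vec n" "w \<in> carrier_vec n" for v w k
  proof -
    have "(v \<bullet> (B ^\<^sub>m k *\<^sub>v w))\<^sup>2 \<le> (v \<bullet> v) * ((B ^\<^sub>m k *\<^sub>v w) \<bullet> (B ^\<^sub>m k *\<^sub>v w))"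
      using scalar_prod_Cauchy_Schwarz[of v "B ^\<^sub>m k *\<^sub>v w"] vw B by simp
    also have "\<dots> \<le> (v \<bullet> v) * (w \<bullet> w)" using Bk_contr[OF vw(2)] by (intro mult_left_mono) auto
    finally show ?thesis by (metis real_sqrt_le_mono real_sqrt_abs)
  qed
  \<comment> \<open>An entry is a form between unit vectors, so each entry series is dominated by
    the summable coefficients. The matrix series can thus be treated entry by entry, without a norm
    on matrices.\<close>
  have entry: "\<bar>(B ^\<^sub>m k) $$ (i,j)\<bar> \<le> 1" if "i < n" "j < n" for i j k
  proof -
    have "unit_vec n i \<bullet> (B ^\<^sub>m k *\<^sub>v unit_vec n j) = (B ^\<^sub>m k) $$ (i,j)"
      using that mult_mat_unit_vec[OF Bk[of k] that] mult_mat_vec_carrier[OF Bk[of k] unit_vec_carrier]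
      by simp
    thus ?thesis using Bk_form[of "unit_vec n i" "unit_vec n j" k] that by simp
  qed
  define t where "t i j k = sqrt_coeff k * (B ^\<^sub>m k) $$ (i,j)" for i j k
  have t_abs: "summable (\<lambda>k. norm (t i j k))" if "i < n" "j < n" for i j
  proof (rule summable_comparison_test_ev[OF always_eventually sqrt_coeff_summable], intro allI)
    fix k show "norm (norm (t i j k)) \<le> \<bar>sqrt_coeff k\<bar>"
      using entry[OF that, of k] by (simp add: t_def abs_mult mult_left_le)
  qed
  define S where "S = Matrix.mat n n (\<lambda>(i,j). \<Sum>k. t i j k)"
  show Sc: "S \<in> carrier_mat n n" by (simp add: S_def)
  have S_sums: "t i j sums (S $$ (i,j))" if "i < n" "j < n" for i j
    using summable_norm_cancel[OF t_abs[OF that]] that by (simp add: S_def summable_sums)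
  have S_sym: "sym_mat S"
  proof -
    have "transpose_mat S = S"
    proof (rule eq_matI)
      fix i j assume "i < dim_row S" "j < dim_col S"
      hence ij: "i < n" "j < n" using Sc by auto
      have "t j i = t i j"
      proof
        fix k
        have "(B ^\<^sub>m k) $$ (j,i) = transpose_mat (B ^\<^sub>m k) $$ (i,j)" using B(1) ij by simp
        thus "t j i k = t i j k" by (simp add: t_def transpose_pow_mat[OF B])
      qed
      thus "transpose_mat S $$ (i,j) = S $$ (i,j)" using ij by (simp add: S_def)
    qed (use Sc in auto)
    thus ?thesis using Sc by (auto simp: sym_mat_def)
  qed
  show "pos_semidef S"
    unfolding pos_semidef_def
  proof (intro conjI ballI)
    show "sym_mat S" by (rule S_sym)
    fix v :: "real Matrix.vec" assume "v \<in> carrier_vec (dim_row S)"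
    hence v: "v \<in> carrier_vec n" using Sc by simp
    have form: "v \<bullet> (M *\<^sub>v v) = (\<Sum>i<n. \<Sum>j<n. v $ i * (v $ j * M $$ (i,j)))"
      if "M \<in> carrier_mat n n" for M :: "real mat"
      using that v by (auto simp: scalar_prod_def atLeast0LessThan sum_distrib_left mult_ac)
    have "(\<lambda>k. \<Sum>i<n. \<Sum>j<n. v $ i * (v $ j * t i j k)) sums (v \<bullet> (S *\<^sub>v v))"
      unfolding form[OF Sc] by (intro sums_sum sums_mult S_sums) auto
    also have "(\<lambda>k. \<Sum>i<n. \<Sum>j<n. v $ i * (v $ j * t i j k)) =
        (\<lambda>k. sqrt_coeff k * (v \<bullet> (B ^\<^sub>m k *\<^sub>v v)))"
      unfolding form[OF Bk] by (simp add: t_def sum_distrib_left mult_ac)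
    finally have lim: "(\<lambda>m. \<Sum>k\<le>m. sqrt_coeff k * (v \<bullet> (B ^\<^sub>m k *\<^sub>v v))) \<longlonglongrightarrow> v \<bullet> (S *\<^sub>v v)"
      by (simp add: sums_def_le)
    \<comment> \<open>Since the coefficients beyond the zeroth are nonpositive, replacing the forms
      of the powers by their upper bound \<open>v \<bullet> v\<close> can only lower a partial sum.
      What is left is a nonnegative partial sum of coefficients times
      \<open>v \<bullet> v\<close>.\<close>
    show "0 \<le> v \<bullet> (S *\<^sub>v v)"
    proof (rule LIMSEQ_le_const[OF lim], intro exI allI impI)
      fix m
      have "0 \<le> (\<Sum>k\<le>m. sqrt_coeff k) * (v \<bullet> v)" using sqrt_coeff_sum_nonneg by simp
      also have "\<dots> = (\<Sum>k\<le>m. sqrt_coeff k * (v \<bullet> v))" by (rule sum_distrib_right)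
      also have "\<dots> \<le> (\<Sum>k\<le>m. sqrt_coeff k * (v \<bullet> (B ^\<^sub>m k *\<^sub>v v)))"
      proof (rule sum_mono)
        fix k
        show "sqrt_coeff k * (v \<bullet> v) \<le> sqrt_coeff k * (v \<bullet> (B ^\<^sub>m k *\<^sub>v v))"
        proof (cases "k = 0")
          case False
          have "v \<bullet> (B ^\<^sub>m k *\<^sub>v v) \<le> v \<bullet> v" using Bk_form[OF v v, of k] by simp
          thus ?thesis using sqrt_coeff_nonpos[of k] False by (simp add: mult_left_mono_neg)
        qed (use v B in auto)
      qed
      finally show "0 \<le> (\<Sum>k\<le>m. sqrt_coeff k * (v \<bullet> (B ^\<^sub>m k *\<^sub>v v)))" .
    qed
  qed
  show "S * S = 1\<^sub>m n - B"
  proof (rule eq_matI)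
    fix i j assume "i < dim_row (1\<^sub>m n - B)" "j < dim_col (1\<^sub>m n - B)"
    hence ij: "i < n" "j < n" using B by auto
    let ?d = "\<lambda>m. (if m = 0 then 1 else if m = 1 then -1 else 0) :: real"
    \<comment> \<open>A Cauchy product is taken for each fixed inner index \<open>l\<close>. Summing
      over \<open>l\<close> turns the products of entries into powers of \<open>B\<close>, and the
      convolution identity leaves only \<open>m = 0\<close> and \<open>m = 1\<close>.\<close>
    have "(\<lambda>m. \<Sum>l<n. \<Sum>k\<le>m. t i l k * t l j (m - k)) sums (\<Sum>l<n. S $$ (i,l) * S $$ (l,j))"
    proof (rule sums_sum)
      fix l assume "l \<in> {..<n}"
      hence l: "l < n" by simp
      show "(\<lambda>m. \<Sum>k\<le>m. t i l k * t l j (m - k)) sums (S $$ (i,l) * S $$ (l,j))"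
        using Cauchy_product_sums[OF t_abs[OF ij(1) l] t_abs[OF l ij(2)]]
          sums_unique[OF S_sums[OF ij(1) l]] sums_unique[OF S_sums[OF l ij(2)]] by simp
    qed
    also have "(\<lambda>m. \<Sum>l<n. \<Sum>k\<le>m. t i l k * t l j (m - k)) = (\<lambda>m. ?d m * (B ^\<^sub>m m) $$ (i,j))"
    proof
      fix m
      have "(\<Sum>l<n. \<Sum>k\<le>m. t i l k * t l j (m - k)) =
          (\<Sum>k\<le>m. sqrt_coeff k * sqrt_coeff (m - k) * (\<Sum>l<n. (B ^\<^sub>m k) $$ (i,l) * (B ^\<^sub>m (m - k)) $$ (l,j)))"
        by (subst sum.swap) (simp add: t_def sum_distrib_left mult_ac)
      also have "\<dots> = (\<Sum>k\<le>m. sqrt_coeff k * sqrt_coeff (m - k) * (B ^\<^sub>m m) $$ (i,j))"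
      proof (rule sum.cong[OF refl])
        fix k assume "k \<in> {..m}"
        hence "B ^\<^sub>m m = B ^\<^sub>m k * B ^\<^sub>m (m - k)" using pow_mat_add[OF B(1), of k "m - k"] by simp
        also have "\<dots> $$ (i,j) = (\<Sum>l<n. (B ^\<^sub>m k) $$ (i,l) * (B ^\<^sub>m (m - k)) $$ (l,j))"
          by (rule index_mult_mat_carrier[OF Bk Bk ij])
        finally have "(B ^\<^sub>m m) $$ (i,j) = (\<Sum>l<n. (B ^\<^sub>m k) $$ (i,l) * (B ^\<^sub>m (m - k)) $$ (l,j))" .
        thus "sqrt_coeff k * sqrt_coeff (m - k) * (\<Sum>l<n. (B ^\<^sub>m k) $$ (i,l) * (B ^\<^sub>m (m - k)) $$ (l,j)) =
          sqrt_coeff k * sqrt_coeff (m - k) * (B ^\<^sub>m m) $$ (i,j)" by simp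
      qed
      also have "\<dots> = ?d m * (B ^\<^sub>m m) $$ (i,j)"
        by (simp only: sum_distrib_right[symmetric] sqrt_coeff_convolution)
      finally show "(\<Sum>l<n. \<Sum>k\<le>m. t i l k * t l j (m - k)) = ?d m * (B ^\<^sub>m m) $$ (i,j)" .
    qed
    finally have "(\<lambda>m. ?d m * (B ^\<^sub>m m) $$ (i,j)) sums (\<Sum>l<n. S $$ (i,l) * S $$ (l,j))" .
    moreover have "(\<lambda>m. ?d m * (B ^\<^sub>m m) $$ (i,j)) sums (\<Sum>m\<in>{0,1}. ?d m * (B ^\<^sub>m m) $$ (i,j))"
      by (rule sums_finite) auto
    ultimately have "(\<Sum>l<n. S $$ (i,l) * S $$ (l,j)) = (\<Sum>m\<in>{0,1}. ?d m * (B ^\<^sub>m m) $$ (i,j))"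
      by (rule sums_unique2)
    thus "(S * S) $$ (i,j) = (1\<^sub>m n - B) $$ (i,j)"
      using ij B unfolding index_mult_mat_carrier[OF Sc Sc ij] by simp
  qed (use Sc B in auto)
  fix C :: "real mat" assume C: "C \<in> carrier_mat n n" "C * B = B * C"
  show "C * S = S * C"
  proof (rule eq_matI)
    fix i j assume "i < dim_row (S * C)" "j < dim_col (S * C)"
    hence ij: "i < n" "j < n" using Sc C by auto
    have "(\<lambda>k. \<Sum>l<n. C $$ (i,l) * t l j k) sums (\<Sum>l<n. C $$ (i,l) * S $$ (l,j))"
      using ij by (intro sums_sum sums_mult S_sums) auto
    moreover have "(\<lambda>k. \<Sum>l<n. t i l k * C $$ (l,j)) sums (\<Sum>l<n. S $$ (i,l) * C $$ (l,j))"
      using ij by (intro sums_sum sums_mult2 S_sums) auto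
    moreover have "(\<Sum>l<n. C $$ (i,l) * t l j k) = (\<Sum>l<n. t i l k * C $$ (l,j))" for k
    proof -
      have "(\<Sum>l<n. C $$ (i,l) * t l j k) = sqrt_coeff k * (C * B ^\<^sub>m k) $$ (i,j)"
        unfolding index_mult_mat_carrier[OF C(1) Bk ij] by (simp add: t_def sum_distrib_left mult_ac)
      also have "\<dots> = (\<Sum>l<n. t i l k * C $$ (l,j))"
        unfolding pow_mat_commute[OF B(1) C] index_mult_mat_carrier[OF Bk C(1) ij]
        by (simp add: t_def sum_distrib_left mult_ac)
      finally show ?thesis .
    qed
    ultimately show "(C * S) $$ (i,j) = (S * C) $$ (i,j)"
      unfolding index_mult_mat_carrier[OF C(1) Sc ij] index_mult_mat_carrier[OF Sc C(1) ij]
      using sums_unique2 by simp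
  qed (use Sc C in auto)
qed

lemma smult_mat_mult_vec:
  fixes A :: "real mat"
  assumes "dim_vec v = dim_col A"
  shows "(a \<cdot>\<^sub>m A) *\<^sub>v v = a \<cdot>\<^sub>v (A *\<^sub>v v)"
  using assms by (intro eq_vecI) auto

text \<open>Scaling makes the power series applicable: \<open>B = I - A / L\<close> is a
  contraction, because \<open>A\<^sup>2 \<le> L A\<close> lets the quadratic term of the squared
  norm of \<open>B v\<close> be absorbed by the linear one. The root of \<open>I - B = A / L\<close>
  is then multiplied by \<open>sqrt L\<close>. Commuting with \<open>A\<close> and commuting with
  \<open>B\<close> amount to the same.\<close>

lemma psd_sqrt_ex:
  fixes A :: "real mat"
  assumes A: "A \<in> carrier_mat n n" "pos_semidef A"
  obtains T where "T \<in> carrier_mat n n" "pos_semidef T" "T * T = A"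
    "\<And>C. C \<in> carrier_mat n n \<Longrightarrow> C * A = A * C \<Longrightarrow> C * T = T * C"
proof -
  obtain L where L1: "L \<ge> 1" and L: "\<And>v. v \<in> carrier_vec n \<Longrightarrow> v \<bullet> (A *\<^sub>v v) \<le> L * (v \<bullet> v)"
    using quad_form_bound[OF A(1)] by blast
  have L0: "L > 0" using L1 by simp
  have A_sym: "transpose_mat A = A" "sym_mat A" using A by (auto simp: pos_semidef_def sym_mat_def)
  define B where "B = 1\<^sub>m n - (1 / L) \<cdot>\<^sub>m A"
  have B: "B \<in> carrier_mat n n" using A by (auto simp: B_def)
  have B_index: "B $$ (i,j) = (if i = j then 1 else 0) - A $$ (i,j) / L" if "i < n" "j < n" for i j
    using that A by (auto simp: B_def)
  have A_index: "A $$ (i,j) = A $$ (j,i)" if "i < n" "j < n" for i j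
    using that A A_sym(1) by (metis carrier_matD index_transpose_mat(1))
  have B_sym: "transpose_mat B = B"
    using B A_index by (intro eq_matI) (auto simp: B_index)
  have contr: "(B *\<^sub>v v) \<bullet> (B *\<^sub>v v) \<le> v \<bullet> v" if v: "v \<in> carrier_vec n" for v
  proof -
    let ?w = "A *\<^sub>v v"
    have w: "?w \<in> carrier_vec n" using A v by auto
    have Bv: "B *\<^sub>v v = v + (- (1 / L)) \<cdot>\<^sub>v ?w"
    proof -
      have "B *\<^sub>v v = 1\<^sub>m n *\<^sub>v v - ((1 / L) \<cdot>\<^sub>m A) *\<^sub>v v"
        unfolding B_def by (rule minus_mult_distrib_mat_vec[of _ n n]) (use A v in auto)
      also have "\<dots> = v + (- (1 / L)) \<cdot>\<^sub>v ?w"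
        using A(1) v by (intro eq_vecI) (auto simp: smult_mat_mult_vec)
      finally show ?thesis .
    qed
    have "(B *\<^sub>v v) \<bullet> (B *\<^sub>v v) = v \<bullet> v - 2 / L * (v \<bullet> ?w) + (?w \<bullet> ?w) / L\<^sup>2"
      unfolding Bv using quad_form_add_smult[of "1\<^sub>m n" n v ?w "- (1 / L)"] v w
      by (auto simp: sym_mat_def power_divide)
    also have "\<dots> \<le> v \<bullet> v - 2 / L * (v \<bullet> ?w) + (L * (v \<bullet> ?w)) / L\<^sup>2"
      using pos_semidef_norm_mult_le[OF A L0 L v] by (simp add: divide_right_mono)
    also have "\<dots> = v \<bullet> v - (v \<bullet> ?w) / L" using L0 by (simp add: field_simps power2_eq_square)
    also have "\<dots> \<le> v \<bullet> v" using A v L0 by (auto simp: pos_semidef_def)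
    finally show ?thesis .
  qed
  obtain S where S: "S \<in> carrier_mat n n" "pos_semidef S" "S * S = 1\<^sub>m n - B"
    and S_comm: "\<And>C. C \<in> carrier_mat n n \<Longrightarrow> C * B = B * C \<Longrightarrow> C * S = S * C"
    using contraction_sqrt_ex[OF B B_sym contr] by metis
  let ?T = "sqrt L \<cdot>\<^sub>m S"
  show ?thesis
  proof
    show Tc: "?T \<in> carrier_mat n n" using S by auto
    have "transpose_mat ?T = sqrt L \<cdot>\<^sub>m transpose_mat S" by (intro eq_matI) auto
    thus "pos_semidef ?T"
      using S L0 by (auto simp: pos_semidef_def sym_mat_def smult_mat_mult_vec)
    have "?T * ?T = (sqrt L * sqrt L) \<cdot>\<^sub>m (S * S)"
      using S(1) by (intro eq_matI) auto
    also have "\<dots> = L \<cdot>\<^sub>m (1\<^sub>m n - B)" using L0 S(3) by simp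
    also have "\<dots> = A" using L0 A B by (intro eq_matI) (auto simp: B_index)
    finally show "?T * ?T = A" .
    fix C assume C: "C \<in> carrier_mat n n" "C * A = A * C"
    have "C * B = C * 1\<^sub>m n - C * ((1 / L) \<cdot>\<^sub>m A)"
      unfolding B_def by (rule mult_minus_distrib_mat) (use A C in auto)
    also have "\<dots> = 1\<^sub>m n * C - ((1 / L) \<cdot>\<^sub>m A) * C"
      using mult_smult_distrib[OF C(1) A(1), of "1/L"] mult_smult_assoc_mat[OF A(1) C(1), of "1/L"] C
      by simp
    also have "\<dots> = B * C"
      unfolding B_def by (rule minus_mult_distrib_mat[symmetric]) (use A C in auto)
    finally have "C * S = S * C" by (rule S_comm[OF C(1)])
    thus "C * ?T = ?T * C"
      using mult_smult_distrib[OF C(1) S(1), of "sqrt L"] mult_smult_assoc_mat[OF S(1) C(1), of "sqrt L"]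
      by simp
  qed
qed

lemma pos_semidef_form_0:
  assumes A: "A \<in> carrier_mat n n" "pos_semidef A" and v: "v \<in> carrier_vec n"
    and 0: "v \<bullet> (A *\<^sub>v v) = 0"
  shows "A *\<^sub>v v = 0\<^sub>v n"
proof -
  obtain L where L1: "L \<ge> 1" and L: "\<And>v. v \<in> carrier_vec n \<Longrightarrow> v \<bullet> (A *\<^sub>v v) \<le> L * (v \<bullet> v)"
    using quad_form_bound[OF A(1)] by blast
  have "(A *\<^sub>v v) \<bullet> (A *\<^sub>v v) \<le> 0"
    using pos_semidef_norm_mult_le[OF A _ L v] L1 0 by simp
  hence "(A *\<^sub>v v) \<bullet> (A *\<^sub>v v) = 0" by (metis antisym scalar_prod_self_nonneg)
  thus ?thesis using scalar_prod_self_eq_0[of "A *\<^sub>v v" n] A v by auto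
qed

text \<open>For commuting roots \<open>(T + C) (T - C) = 0\<close>. On \<open>u = (T - C) v\<close>
  the forms of \<open>T\<close> and \<open>C\<close> are nonnegative and opposite, so both vanish;
  hence \<open>T u = C u = 0\<close>, and symmetry gives
  \<open>u \<bullet> u = v \<bullet> (T - C) u = 0\<close>.\<close>

lemma psd_sqrt_unique:
  fixes T C :: "real mat"
  assumes T: "T \<in> carrier_mat n n" "pos_semidef T" and C: "C \<in> carrier_mat n n" "pos_semidef C"
    and sq: "T * T = C * C" and comm: "C * T = T * C"
  shows "T = C"
proof (rule mat_eq_mult_vec[OF T(1) C(1)])
  fix v :: "real Matrix.vec" assume v: "v \<in> carrier_vec n"
  let ?u = "T *\<^sub>v v - C *\<^sub>v v"
  have Tv: "T *\<^sub>v v \<in> carrier_vec n" and Cv: "C *\<^sub>v v \<in> carrier_vec n" using T C v by auto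
  hence u: "?u \<in> carrier_vec n" by auto
  have TTv: "T *\<^sub>v (T *\<^sub>v v) = C *\<^sub>v (C *\<^sub>v v)" and CTv: "C *\<^sub>v (T *\<^sub>v v) = T *\<^sub>v (C *\<^sub>v v)"
    using sq comm T(1) C(1) v by (metis assoc_mult_mat_vec)+
  have Tu: "T *\<^sub>v ?u = T *\<^sub>v (T *\<^sub>v v) - T *\<^sub>v (C *\<^sub>v v)"
    by (rule mult_minus_distrib_mat_vec[OF T(1) Tv Cv])
  have Cu: "C *\<^sub>v ?u = C *\<^sub>v (T *\<^sub>v v) - C *\<^sub>v (C *\<^sub>v v)"
    by (rule mult_minus_distrib_mat_vec[OF C(1) Tv Cv])
  have "T *\<^sub>v ?u = (-1) \<cdot>\<^sub>v (C *\<^sub>v ?u)"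
    unfolding Tu Cu TTv CTv using T C Tv Cv by (intro eq_vecI) auto
  hence "?u \<bullet> (T *\<^sub>v ?u) = - (?u \<bullet> (C *\<^sub>v ?u))"
    using u C by (simp add: scalar_prod_smult_distrib[of _ n])
  moreover have "?u \<bullet> (T *\<^sub>v ?u) \<ge> 0" "?u \<bullet> (C *\<^sub>v ?u) \<ge> 0"
    using T C u by (auto simp: pos_semidef_def)
  ultimately have "?u \<bullet> (T *\<^sub>v ?u) = 0" "?u \<bullet> (C *\<^sub>v ?u) = 0" by linarith+
  hence Tu0: "T *\<^sub>v ?u = 0\<^sub>v n" and Cu0: "C *\<^sub>v ?u = 0\<^sub>v n"
    using pos_semidef_form_0 T C u by blast+
  have "?u \<bullet> ?u = (T *\<^sub>v v) \<bullet> ?u - (C *\<^sub>v v) \<bullet> ?u"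
    by (rule minus_scalar_prod_distrib[OF Tv Cv u])
  also have "\<dots> = v \<bullet> (T *\<^sub>v ?u) - v \<bullet> (C *\<^sub>v ?u)"
    using sym_mat_scalar_prod[OF _ T(1) v u] sym_mat_scalar_prod[OF _ C(1) v u] T C
    by (simp add: pos_semidef_def)
  also have "\<dots> = 0" unfolding Tu0 Cu0 by simp
  finally have "?u = 0\<^sub>v n" using scalar_prod_self_eq_0[OF u] by simp
  thus "T *\<^sub>v v = C *\<^sub>v v" by (rule vec_eq_if_diff_0[OF Tv Cv])
qed

text \<open>A competing root \<open>C\<close> commutes with its own square \<open>A\<close>, hence
  with the constructed root \<open>T\<close>, which commutes with everything that commutes with
  \<open>A\<close>. This supplies the commutation under which roots are known to coincide, and so
  settles the definite description.\<close>

lemma msqrt_props: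
  assumes A: "A \<in> carrier_mat n n" "pos_semidef A"
  shows "msqrt A \<in> carrier_mat n n" "pos_semidef (msqrt A)" "msqrt A * msqrt A = A"
proof -
  obtain T where T: "T \<in> carrier_mat n n" "pos_semidef T" "T * T = A"
    and comm: "\<And>C. C \<in> carrier_mat n n \<Longrightarrow> C * A = A * C \<Longrightarrow> C * T = T * C"
    using psd_sqrt_ex[OF A] by metis
  have "msqrt A = T"
    unfolding msqrt_def
  proof (rule the_equality)
    show "T \<in> carrier_mat (dim_row A) (dim_row A) \<and> pos_semidef T \<and> T * T = A" using T A by simp
    fix C assume "C \<in> carrier_mat (dim_row A) (dim_row A) \<and> pos_semidef C \<and> C * C = A"
    hence C: "C \<in> carrier_mat n n" "pos_semidef C" "C * C = A" using A by auto
    have "C * A = A * C" unfolding C(3)[symmetric] using C(1) by (simp add: assoc_mult_mat[OF C(1) C(1) C(1)])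
    hence "C * T = T * C" by (rule comm[OF C(1)])
    thus "C = T" using psd_sqrt_unique[OF T(1,2) C(1,2)] T C by simp
  qed
  with T show "msqrt A \<in> carrier_mat n n" "pos_semidef (msqrt A)" "msqrt A * msqrt A = A" by auto
qed

subsection \<open>Inverses\<close>

lemma minv_eq:
  assumes A: "A \<in> carrier_mat n n" and B: "B \<in> carrier_mat n n" "A * B = 1\<^sub>m n" "B * A = 1\<^sub>m n"
  shows "minv A = B"
  unfolding minv_def
proof (rule the_equality)
  show "B \<in> carrier_mat (dim_row A) (dim_row A) \<and> A * B = 1\<^sub>m (dim_row A) \<and> B * A = 1\<^sub>m (dim_row A)"
    using A B by simp
  fix C assume "C \<in> carrier_mat (dim_row A) (dim_row A) \<and> A * C = 1\<^sub>m (dim_row A) \<and> C * A = 1\<^sub>m (dim_row A)"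
  hence C: "C \<in> carrier_mat n n" "A * C = 1\<^sub>m n" using A by auto
  have "C = (B * A) * C" using B C by simp
  also have "\<dots> = B * (A * C)" by (rule assoc_mult_mat[OF B(1) A C(1)])
  also have "\<dots> = B" using B C by simp
  finally show "C = B" .
qed

lemma pos_def_minv:
  assumes A: "A \<in> carrier_mat n n" and pd: "pos_def A"
  shows "minv A \<in> carrier_mat n n" "A * minv A = 1\<^sub>m n" "minv A * A = 1\<^sub>m n"
proof -
  have "det A \<noteq> 0"
  proof
    assume "det A = 0"
    then obtain v where v: "v \<in> carrier_vec n" "v \<noteq> 0\<^sub>v n" "A *\<^sub>v v = 0\<^sub>v n"
      using det_0_iff_vec_prod_zero[OF A] by blast
    hence "v \<bullet> (A *\<^sub>v v) = 0" by simp
    thus False using pd A v unfolding pos_def_def by (metis carrier_matD(1) less_irrefl)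
  qed
  from det_non_zero_imp_unit[OF A this, of "()"]
  obtain B where "B \<in> carrier_mat n n" "A * B = 1\<^sub>m n" "B * A = 1\<^sub>m n"
    by (auto simp: Units_def ring_mat_def)
  with minv_eq[OF A] show "minv A \<in> carrier_mat n n" "A * minv A = 1\<^sub>m n" "minv A * A = 1\<^sub>m n"
    by simp_all
qed

subsection \<open>Stability and output energy\<close>

lemma scalar_prod_sum_lessThan: "w \<in> carrier_vec n \<Longrightarrow> v \<bullet> w = (\<Sum>i<n. v $ i * w $ i)"
  by (auto simp: scalar_prod_def atLeast0LessThan)

lemma ltv_traj_carrier:
  assumes "\<And>k. Mk k \<in> carrier_mat n n" "x0 \<in> carrier_vec n"
  shows "ltv_traj Mk x0 k \<in> carrier_vec n"
  using assms by (induction k) (auto intro: mult_mat_vec_carrier)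

section \<open>Decay of trajectories without noise\<close>

context
  fixes n :: nat and Mk :: "nat \<Rightarrow> real mat" and P :: "real mat"
  assumes Mk: "\<And>k. Mk k \<in> carrier_mat n n"
    and P: "P \<in> carrier_mat n n"
    and lyap: "\<And>k v. v \<in> carrier_vec n \<Longrightarrow>
      (transpose_mat (Mk k) *\<^sub>v v) \<bullet> (P *\<^sub>v (transpose_mat (Mk k) *\<^sub>v v)) + v \<bullet> v \<le> v \<bullet> (P *\<^sub>v v)"
    and P_ge: "\<And>v. v \<in> carrier_vec n \<Longrightarrow> v \<bullet> v \<le> v \<bullet> (P *\<^sub>v v)"
begin

text \<open>The rate comes from \<open>v \<bullet> v \<ge> (v \<bullet> P v) / L\<close>: the gain
  in the Lyapunov inequality is a fixed fraction of the form itself. The induction has to range over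
  all \<open>v\<close>, as splitting off the last factor of the trajectory replaces \<open>v\<close>
  by its image under the transposed matrix.\<close>

lemma ltv_traj_functional_decay:
  assumes L: "L \<ge> 1" "\<And>v. v \<in> carrier_vec n \<Longrightarrow> v \<bullet> (P *\<^sub>v v) \<le> L * (v \<bullet> v)"
    and x0: "x0 \<in> carrier_vec n" and v: "v \<in> carrier_vec n"
  shows "(v \<bullet> ltv_traj Mk x0 k)\<^sup>2 \<le> (1 - 1 / L) ^ k * (v \<bullet> (P *\<^sub>v v)) * (x0 \<bullet> x0)"
  using v
proof (induction k arbitrary: v)
  case 0
  have "(v \<bullet> x0)\<^sup>2 \<le> (v \<bullet> v) * (x0 \<bullet> x0)"
    using 0 x0 by (intro scalar_prod_Cauchy_Schwarz) auto
  also have "\<dots> \<le> (v \<bullet> (P *\<^sub>v v)) * (x0 \<bullet> x0)"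
    using P_ge[OF 0] by (intro mult_right_mono) auto
  finally show ?case by simp
next
  case (Suc k)
  let ?u = "transpose_mat (Mk k) *\<^sub>v v" and ?r = "1 - 1 / L"
  have u: "?u \<in> carrier_vec n" using Mk[of k] Suc.prems by auto
  have r: "?r \<ge> 0" using L by simp
  have "(v \<bullet> ltv_traj Mk x0 (Suc k))\<^sup>2 = (?u \<bullet> ltv_traj Mk x0 k)\<^sup>2"
    using adjoint_scalar_prod[OF Mk Suc.prems ltv_traj_carrier[OF Mk x0]] by simp
  also have "\<dots> \<le> ?r ^ k * (?u \<bullet> (P *\<^sub>v ?u)) * (x0 \<bullet> x0)" by (rule Suc.IH[OF u])
  also have "\<dots> \<le> ?r ^ k * (?r * (v \<bullet> (P *\<^sub>v v))) * (x0 \<bullet> x0)"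
  proof (intro mult_right_mono mult_left_mono)
    have "v \<bullet> (P *\<^sub>v v) / L \<le> v \<bullet> v" using L(2)[OF Suc.prems] L(1) by (simp add: field_simps)
    thus "?u \<bullet> (P *\<^sub>v ?u) \<le> ?r * (v \<bullet> (P *\<^sub>v v))"
      using lyap[OF Suc.prems, of k] by (simp add: left_diff_distrib)
  qed (use r in auto)
  finally show ?case by (simp add: mult_ac)
qed

text \<open>The functional is chosen as the state \<open>x\<close> at time \<open>k\<close> itself.
  The left side becomes the fourth power of its norm, the form on the right is at most
  \<open>L\<close> times the square, and one factor \<open>x \<bullet> x\<close> cancels.\<close>

lemma asym_stable_if_lyapunov: "asym_stable n Mk"
proof -
  obtain L where L: "L \<ge> 1" "\<And>v. v \<in> carrier_vec n \<Longrightarrow> v \<bullet> (P *\<^sub>v v) \<le> L * (v \<bullet> v)"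
    using quad_form_bound[OF P] by blast
  let ?r = "1 - 1 / L"
  have r: "0 \<le> ?r" "?r < 1" using L(1) by auto
  have decay: "vnorm (ltv_traj Mk x0 k) \<le> sqrt (?r ^ k * L) * vnorm x0" if x0: "x0 \<in> carrier_vec n" for x0 k
  proof -
    let ?x = "ltv_traj Mk x0 k"
    have x: "?x \<in> carrier_vec n" by (rule ltv_traj_carrier[OF Mk x0])
    have "(?x \<bullet> ?x)\<^sup>2 \<le> ?r ^ k * (?x \<bullet> (P *\<^sub>v ?x)) * (x0 \<bullet> x0)"
      by (rule ltv_traj_functional_decay[OF L x0 x])
    also have "\<dots> \<le> ?r ^ k * (L * (?x \<bullet> ?x)) * (x0 \<bullet> x0)"
      using L(2)[OF x] r by (intro mult_right_mono mult_left_mono) auto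
    finally have le: "(?x \<bullet> ?x) * (?x \<bullet> ?x) \<le> (?x \<bullet> ?x) * (?r ^ k * L * (x0 \<bullet> x0))"
      by (simp add: power2_eq_square mult_ac)
    have "?x \<bullet> ?x \<le> ?r ^ k * L * (x0 \<bullet> x0)"
    proof (cases "?x \<bullet> ?x = 0")
      case True
      have "0 \<le> ?r ^ k * L * (x0 \<bullet> x0)" using r L(1) by (intro mult_nonneg_nonneg) auto
      thus ?thesis unfolding True .
    next
      case False
      hence "?x \<bullet> ?x > 0" using scalar_prod_self_nonneg[of ?x] by linarith
      thus ?thesis using le by (metis mult_le_cancel_left_pos)
    qed
    thus ?thesis unfolding vnorm_def by (metis real_sqrt_le_mono real_sqrt_mult)
  qed
  show ?thesis
    unfolding asym_stable_def
  proof (intro conjI allI impI ballI)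
    fix e :: real assume e: "e > 0"
    have bound: "vnorm (ltv_traj Mk x0 k) < e" if x0: "x0 \<in> carrier_vec n" "vnorm x0 < e / sqrt L" for x0 k
    proof -
      have "?r ^ k * L \<le> L" using r L(1) by (simp add: mult_le_cancel_right1 power_le_one)
      hence "sqrt (?r ^ k * L) * vnorm x0 \<le> sqrt L * vnorm x0"
        by (intro mult_right_mono) (auto simp: vnorm_def)
      also have "\<dots> < e" using x0 L(1) by (simp add: field_simps)
      finally show ?thesis using decay[OF x0(1), of k] by linarith
    qed
    show "\<exists>d>0. \<forall>x0\<in>carrier_vec n. vnorm x0 < d \<longrightarrow> (\<forall>k. vnorm (ltv_traj Mk x0 k) < e)"
    proof (intro exI conjI ballI impI allI)
      show "e / sqrt L > 0" by (rule divide_pos_pos[OF e]) (use L(1) in simp)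
    qed (rule bound)
  next
    fix x0 :: "real Matrix.vec" assume x0: "x0 \<in> carrier_vec n"
    have "(\<lambda>k. sqrt (?r ^ k * L) * vnorm x0) \<longlonglongrightarrow> sqrt (0 * L) * vnorm x0"
      using r by (intro tendsto_intros LIMSEQ_realpow_zero) auto
    hence lim: "(\<lambda>k. sqrt (?r ^ k * L) * vnorm x0) \<longlonglongrightarrow> 0"
      by (simp only: mult_zero_left real_sqrt_zero)
    have nonneg: "0 \<le> vnorm (ltv_traj Mk x0 k)" for k by (simp add: vnorm_def)
    show "(\<lambda>k. vnorm (ltv_traj Mk x0 k)) \<longlonglongrightarrow> 0"
      by (rule tendsto_sandwich[OF always_eventually always_eventually tendsto_const lim])
        (intro allI nonneg decay[OF x0])+
  qed
qed

end

section \<open>Square-integrable random variables\<close>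

definition sq_integrable :: "'w measure \<Rightarrow> ('w \<Rightarrow> real) \<Rightarrow> bool" where
  "sq_integrable M f \<longleftrightarrow> f \<in> borel_measurable M \<and> integrable M (\<lambda>\<omega>. (f \<omega>)\<^sup>2)"

text \<open>The noise is constrained only on \<open>space M\<close>, so the index formulas for the
  trajectory are available only there. Rewriting inside \<open>sq_integrable\<close> has to respect
  this.\<close>

lemma sq_integrable_cong:
  "(\<And>\<omega>. \<omega> \<in> space M \<Longrightarrow> f \<omega> = g \<omega>) \<Longrightarrow> sq_integrable M f \<longleftrightarrow> sq_integrable M g"
  unfolding sq_integrable_def
  by (intro arg_cong2[of _ _ _ _ "(\<and>)"] measurable_cong Bochner_Integration.integrable_cong) auto

lemma sq_integrable_mult:
  assumes "sq_integrable M f" "sq_integrable M g"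
  shows "integrable M (\<lambda>\<omega>. f \<omega> * g \<omega>)"
proof (rule Bochner_Integration.integrable_bound)
  show "integrable M (\<lambda>\<omega>. (f \<omega>)\<^sup>2 + (g \<omega>)\<^sup>2)"
    using assms by (auto simp: sq_integrable_def)
  show "(\<lambda>\<omega>. f \<omega> * g \<omega>) \<in> borel_measurable M"
    using assms by (auto simp: sq_integrable_def)
  have "\<bar>a * b\<bar> \<le> a\<^sup>2 + b\<^sup>2" for a b :: real
    using sum_squares_bound[of "\<bar>a\<bar>" "\<bar>b\<bar>"] mult_nonneg_nonneg[OF abs_ge_zero[of a] abs_ge_zero[of b]]
    unfolding abs_mult power2_abs by linarith
  thus "AE \<omega> in M. norm (f \<omega> * g \<omega>) \<le> norm ((f \<omega>)\<^sup>2 + (g \<omega>)\<^sup>2)" by simp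
qed

lemma sq_integrable_add:
  assumes "sq_integrable M f" "sq_integrable M g"
  shows "sq_integrable M (\<lambda>\<omega>. f \<omega> + g \<omega>)"
proof -
  have "integrable M (\<lambda>\<omega>. (f \<omega>)\<^sup>2 + (g \<omega>)\<^sup>2 + 2 * (f \<omega> * g \<omega>))"
    using assms sq_integrable_mult[OF assms] by (auto simp: sq_integrable_def)
  thus ?thesis using assms by (auto simp: sq_integrable_def power2_sum mult_ac)
qed

lemma sq_integrable_cmult: "sq_integrable M f \<Longrightarrow> sq_integrable M (\<lambda>\<omega>. c * f \<omega>)"
  by (auto simp: sq_integrable_def power_mult_distrib)

lemma sq_integrable_lincomb:
  fixes n :: nat
  assumes "\<And>i. i < n \<Longrightarrow> sq_integrable M (\<lambda>\<omega>. f \<omega> i)"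
  shows "sq_integrable M (\<lambda>\<omega>. \<Sum>i<n. a i * f \<omega> i)"
  using assms
proof (induction n)
  case 0
  show ?case by (simp add: sq_integrable_def)
next
  case (Suc n)
  thus ?case by (auto intro!: sq_integrable_add sq_integrable_cmult)
qed

lemma integral_lincomb:
  fixes a :: "'i \<Rightarrow> real"
  assumes "\<And>i. i \<in> I \<Longrightarrow> integrable M (h i)"
  shows "integrable M (\<lambda>\<omega>. \<Sum>i\<in>I. a i * h i \<omega>)"
    and "(\<integral>\<omega>. (\<Sum>i\<in>I. a i * h i \<omega>) \<partial>M) = (\<Sum>i\<in>I. a i * (\<integral>\<omega>. h i \<omega> \<partial>M))"
proof -
  have int: "integrable M (\<lambda>\<omega>. a i * h i \<omega>)" if "i \<in> I" for i
    by (intro integrable_mult_right assms that)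
  show "integrable M (\<lambda>\<omega>. \<Sum>i\<in>I. a i * h i \<omega>)"
    by (intro Bochner_Integration.integrable_sum int)
  have "(\<integral>\<omega>. (\<Sum>i\<in>I. a i * h i \<omega>) \<partial>M) = (\<Sum>i\<in>I. \<integral>\<omega>. a i * h i \<omega> \<partial>M)"
    by (intro Bochner_Integration.integral_sum int)
  thus "(\<integral>\<omega>. (\<Sum>i\<in>I. a i * h i \<omega>) \<partial>M) = (\<Sum>i\<in>I. a i * (\<integral>\<omega>. h i \<omega> \<partial>M))"
    by simp
qed

lemma integral_mult_lincomb:
  fixes n :: nat
  assumes "\<And>i. i < n \<Longrightarrow> sq_integrable M (\<lambda>\<omega>. f \<omega> i)" "\<And>i. i < n \<Longrightarrow> sq_integrable M (\<lambda>\<omega>. g \<omega> i)"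
  shows "(\<integral>\<omega>. (\<Sum>i<n. a i * f \<omega> i) * (\<Sum>j<n. b j * g \<omega> j) \<partial>M) =
    (\<Sum>i<n. a i * (\<Sum>j<n. b j * (\<integral>\<omega>. f \<omega> i * g \<omega> j \<partial>M)))"
proof -
  have int: "integrable M (\<lambda>\<omega>. f \<omega> i * g \<omega> j)" if "i \<in> {..<n}" "j \<in> {..<n}" for i j
    using sq_integrable_mult[OF assms] that by simp
  have "(\<integral>\<omega>. (\<Sum>i<n. a i * f \<omega> i) * (\<Sum>j<n. b j * g \<omega> j) \<partial>M) =
      (\<integral>\<omega>. (\<Sum>i<n. a i * (\<Sum>j<n. b j * (f \<omega> i * g \<omega> j))) \<partial>M)"
    unfolding sum_product by (simp add: sum_distrib_left mult_ac)
  also have "\<dots> = (\<Sum>i<n. a i * (\<integral>\<omega>. (\<Sum>j<n. b j * (f \<omega> i * g \<omega> j)) \<partial>M))"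
    by (intro integral_lincomb int)
  also have "\<dots> = (\<Sum>i<n. a i * (\<Sum>j<n. b j * (\<integral>\<omega>. f \<omega> i * g \<omega> j \<partial>M)))"
    by (intro sum.cong arg_cong2[of _ _ _ _ "(*)"] refl integral_lincomb int)
  finally show ?thesis .
qed

section \<open>Second moments of trajectories driven by white noise\<close>

context
  fixes M :: "'w measure" and n :: nat and w :: "nat \<Rightarrow> 'w \<Rightarrow> real Matrix.vec" and Mk :: "nat \<Rightarrow> real mat"
  assumes wn: "white_noise M n w" and Mk: "\<And>k. Mk k \<in> carrier_mat n n"
begin

lemma white_noise_carrier: "\<omega> \<in> space M \<Longrightarrow> w k \<omega> \<in> carrier_vec n"
  using wn by (auto simp: white_noise_def)

lemma white_noise_sq_integrable: "i < n \<Longrightarrow> sq_integrable M (\<lambda>\<omega>. w k \<omega> $ i)"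
  using wn by (auto simp: white_noise_def sq_integrable_def)

lemma white_noise_cov:
  "i < n \<Longrightarrow> l < n \<Longrightarrow> (\<integral>\<omega>. w k \<omega> $ i * w j \<omega> $ l \<partial>M) = (if k = j \<and> i = l then 1 else 0)"
  using wn unfolding white_noise_def by blast

lemma noisy_traj_carrier: "\<omega> \<in> space M \<Longrightarrow> noisy_traj n Mk w k \<omega> \<in> carrier_vec n"
  using Mk white_noise_carrier by (induction k) (auto intro!: add_carrier_vec mult_mat_vec_carrier)

lemma noisy_traj_Suc_index:
  assumes "\<omega> \<in> space M" "i < n"
  shows "noisy_traj n Mk w (Suc k) \<omega> $ i =
    (\<Sum>j<n. Mk k $$ (i,j) * noisy_traj n Mk w k \<omega> $ j) + w k \<omega> $ i"
  using assms Mk[of k] noisy_traj_carrier[OF assms(1), of k] white_noise_carrier[OF assms(1), of k]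
  by (auto simp: scalar_prod_def atLeast0LessThan)

lemma noisy_traj_sq_integrable: "i < n \<Longrightarrow> sq_integrable M (\<lambda>\<omega>. noisy_traj n Mk w k \<omega> $ i)"
proof (induction k arbitrary: i)
  case 0
  thus ?case by (simp add: sq_integrable_def)
next
  case (Suc k)
  have "sq_integrable M (\<lambda>\<omega>. (\<Sum>j<n. Mk k $$ (i,j) * noisy_traj n Mk w k \<omega> $ j) + w k \<omega> $ i)"
    using Suc by (intro sq_integrable_add sq_integrable_lincomb white_noise_sq_integrable) auto
  thus ?case
    by (subst sq_integrable_cong[OF noisy_traj_Suc_index[OF _ Suc.prems]])
qed

text \<open>The state at time \<open>k\<close> is a linear combination of the noises before
  \<open>k\<close>, since it starts at zero. Uncorrelatedness in time thus suffices, and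
  \<open>k \<le> j\<close> includes the noise that enters at time \<open>k\<close> itself.\<close>

lemma noisy_traj_noise_orthogonal:
  assumes "k \<le> j" "i < n" "l < n"
  shows "(\<integral>\<omega>. noisy_traj n Mk w k \<omega> $ i * w j \<omega> $ l \<partial>M) = 0"
  using assms
proof (induction k arbitrary: i)
  case 0
  thus ?case by simp
next
  case (Suc k)
  let ?x = "\<lambda>\<omega> i. noisy_traj n Mk w k \<omega> $ i"
  have int: "integrable M (\<lambda>\<omega>. ?x \<omega> m * w j \<omega> $ l)" if "m < n" for m
    using that Suc.prems by (intro sq_integrable_mult noisy_traj_sq_integrable white_noise_sq_integrable)
  have int': "integrable M (\<lambda>\<omega>. w k \<omega> $ i * w j \<omega> $ l)"
    using Suc.prems by (intro sq_integrable_mult white_noise_sq_integrable)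
  have "(\<integral>\<omega>. noisy_traj n Mk w (Suc k) \<omega> $ i * w j \<omega> $ l \<partial>M) =
      (\<integral>\<omega>. (\<Sum>m<n. Mk k $$ (i,m) * (?x \<omega> m * w j \<omega> $ l)) + w k \<omega> $ i * w j \<omega> $ l \<partial>M)"
    by (rule Bochner_Integration.integral_cong[OF refl])
       (simp only: noisy_traj_Suc_index[OF _ Suc.prems(2)] distrib_right sum_distrib_right mult.assoc)
  also have "\<dots> = (\<Sum>m<n. Mk k $$ (i,m) * (\<integral>\<omega>. ?x \<omega> m * w j \<omega> $ l \<partial>M)) + (\<integral>\<omega>. w k \<omega> $ i * w j \<omega> $ l \<partial>M)"
    using integral_lincomb[of "{..<n}" M "\<lambda>m \<omega>. ?x \<omega> m * w j \<omega> $ l" "\<lambda>m. Mk k $$ (i,m)", OF int] int'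
    by (subst Bochner_Integration.integral_add) simp_all
  also have "\<dots> = 0"
    using Suc white_noise_cov by simp
  finally show ?case .
qed

text \<open>The cross term vanishes by orthogonality of the state to the noise entering at the same
  time, and the unit covariance turns the noise term into \<open>v \<bullet> v\<close>.\<close>

lemma noisy_traj_second_moment_Suc:
  assumes v: "v \<in> carrier_vec n"
  defines "u k \<equiv> transpose_mat (Mk k) *\<^sub>v v"
  shows "(\<integral>\<omega>. (v \<bullet> noisy_traj n Mk w (Suc k) \<omega>)\<^sup>2 \<partial>M) =
    (\<integral>\<omega>. (u k \<bullet> noisy_traj n Mk w k \<omega>)\<^sup>2 \<partial>M) + v \<bullet> v"
proof -
  let ?x = "\<lambda>\<omega> i. noisy_traj n Mk w k \<omega> $ i"
  let ?X = "\<lambda>\<omega>. \<Sum>i<n. u k $ i * ?x \<omega> i" and ?W = "\<lambda>\<omega>. \<Sum>i<n. v $ i * w k \<omega> $ i"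
  have X: "sq_integrable M ?X" and W: "sq_integrable M ?W"
    by (intro sq_integrable_lincomb noisy_traj_sq_integrable white_noise_sq_integrable; simp)+
  have Xeq: "u k \<bullet> noisy_traj n Mk w k \<omega> = ?X \<omega>" if "\<omega> \<in> space M" for \<omega>
    by (rule scalar_prod_sum_lessThan[OF noisy_traj_carrier[OF that]])
  have eq: "v \<bullet> noisy_traj n Mk w (Suc k) \<omega> = ?X \<omega> + ?W \<omega>" if \<omega>: "\<omega> \<in> space M" for \<omega>
  proof -
    have "v \<bullet> noisy_traj n Mk w (Suc k) \<omega> = v \<bullet> (Mk k *\<^sub>v noisy_traj n Mk w k \<omega>) + v \<bullet> w k \<omega>"
      using v Mk noisy_traj_carrier[OF \<omega>] white_noise_carrier[OF \<omega>]
      by (simp add: scalar_prod_add_distrib[of _ n] mult_mat_vec_carrier[of _ n n])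
    thus ?thesis
      using adjoint_scalar_prod[OF Mk v noisy_traj_carrier[OF \<omega>], of k k] Xeq[OF \<omega>]
        scalar_prod_sum_lessThan[OF white_noise_carrier[OF \<omega>]] by (simp add: u_def)
  qed
  have "(\<integral>\<omega>. (v \<bullet> noisy_traj n Mk w (Suc k) \<omega>)\<^sup>2 \<partial>M) =
      (\<integral>\<omega>. (?X \<omega>)\<^sup>2 + 2 * (?X \<omega> * ?W \<omega>) + ?W \<omega> * ?W \<omega> \<partial>M)"
    by (rule Bochner_Integration.integral_cong[OF refl])
       (simp only: eq power2_eq_square, simp add: algebra_simps)
  also have "\<dots> = (\<integral>\<omega>. (?X \<omega>)\<^sup>2 \<partial>M) + 2 * (\<integral>\<omega>. ?X \<omega> * ?W \<omega> \<partial>M) + (\<integral>\<omega>. ?W \<omega> * ?W \<omega> \<partial>M)"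
    using X sq_integrable_mult[OF X W] sq_integrable_mult[OF W W]
    by (simp add: sq_integrable_def Bochner_Integration.integral_add del: power2_eq_square)
  also have "(\<integral>\<omega>. ?X \<omega> * ?W \<omega> \<partial>M) = 0"
    by (subst integral_mult_lincomb)
       (auto simp: noisy_traj_noise_orthogonal noisy_traj_sq_integrable white_noise_sq_integrable)
  also have "(\<integral>\<omega>. ?W \<omega> * ?W \<omega> \<partial>M) = v \<bullet> v"
  proof -
    have "(\<integral>\<omega>. ?W \<omega> * ?W \<omega> \<partial>M) = (\<Sum>i<n. v $ i * (\<Sum>j<n. v $ j * (if i = j then 1 else 0)))"
      by (subst integral_mult_lincomb) (auto simp: white_noise_sq_integrable white_noise_cov intro!: sum.cong)
    also have "\<dots> = (\<Sum>i<n. v $ i * v $ i)"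
      by (rule sum.cong) (auto simp: if_distrib sum.delta cong: if_cong)
    also have "\<dots> = v \<bullet> v" by (rule scalar_prod_sum_lessThan[OF v, symmetric])
    finally show ?thesis .
  qed
  also have "(\<integral>\<omega>. (?X \<omega>)\<^sup>2 \<partial>M) = (\<integral>\<omega>. (u k \<bullet> noisy_traj n Mk w k \<omega>)\<^sup>2 \<partial>M)"
    by (rule Bochner_Integration.integral_cong[OF refl]) (simp add: Xeq)
  finally show ?thesis by simp
qed

text \<open>The moment recursion and the Lyapunov inequality have the same shape, with the same
  increment \<open>v \<bullet> v\<close>. The zero initial state makes the bound hold at time
  0.\<close>

lemma noisy_traj_second_moment_le:
  assumes lyap: "\<And>k v. v \<in> carrier_vec n \<Longrightarrow>
      (transpose_mat (Mk k) *\<^sub>v v) \<bullet> (P *\<^sub>v (transpose_mat (Mk k) *\<^sub>v v)) + v \<bullet> v \<le> v \<bullet> (P *\<^sub>v v)"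
    and P_ge: "\<And>v. v \<in> carrier_vec n \<Longrightarrow> v \<bullet> v \<le> v \<bullet> (P *\<^sub>v v)"
    and v: "v \<in> carrier_vec n"
  shows "(\<integral>\<omega>. (v \<bullet> noisy_traj n Mk w k \<omega>)\<^sup>2 \<partial>M) \<le> v \<bullet> (P *\<^sub>v v)"
  using v
proof (induction k arbitrary: v)
  case 0
  have "0 \<le> v \<bullet> (P *\<^sub>v v)" using P_ge[OF 0] scalar_prod_self_nonneg[of v] by linarith
  thus ?case using 0 by simp
next
  case (Suc k)
  let ?u = "transpose_mat (Mk k) *\<^sub>v v"
  have u: "?u \<in> carrier_vec n" using Mk[of k] Suc.prems by auto
  show ?case
    using noisy_traj_second_moment_Suc[OF Suc.prems, of k] Suc.IH[OF u] lyap[OF Suc.prems, of k] by simp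
qed

text \<open>The output energy is the sum of the squared functionals given by the rows of
  \<open>C\<close>. Integrability is recorded because the expectation is later exchanged with the
  sum over time.\<close>

lemma output_energy:
  assumes lyap: "\<And>k v. v \<in> carrier_vec n \<Longrightarrow>
      (transpose_mat (Mk k) *\<^sub>v v) \<bullet> (P *\<^sub>v (transpose_mat (Mk k) *\<^sub>v v)) + v \<bullet> v \<le> v \<bullet> (P *\<^sub>v v)"
    and P_ge: "\<And>v. v \<in> carrier_vec n \<Longrightarrow> v \<bullet> v \<le> v \<bullet> (P *\<^sub>v v)"
    and C: "C \<in> carrier_mat m n"
  defines "z \<equiv> \<lambda>k \<omega>. C *\<^sub>v noisy_traj n Mk w k \<omega>"
  shows "integrable M (\<lambda>\<omega>. z k \<omega> \<bullet> z k \<omega>)"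
    and "(\<integral>\<omega>. z k \<omega> \<bullet> z k \<omega> \<partial>M) \<le> (\<Sum>i<m. row C i \<bullet> (P *\<^sub>v row C i))"
proof -
  let ?x = "noisy_traj n Mk w k"
  have zz: "z k \<omega> \<bullet> z k \<omega> = (\<Sum>i<m. (row C i \<bullet> ?x \<omega>)\<^sup>2)" for \<omega>
    using C by (auto simp: z_def scalar_prod_self_sum)
  have int: "integrable M (\<lambda>\<omega>. (row C i \<bullet> ?x \<omega>)\<^sup>2)" for i
  proof -
    have "sq_integrable M (\<lambda>\<omega>. \<Sum>j<n. row C i $ j * ?x \<omega> $ j)"
      by (intro sq_integrable_lincomb noisy_traj_sq_integrable)
    hence "sq_integrable M (\<lambda>\<omega>. row C i \<bullet> ?x \<omega>)"
      by (subst sq_integrable_cong[OF scalar_prod_sum_lessThan[OF noisy_traj_carrier]])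
    thus ?thesis by (simp add: sq_integrable_def)
  qed
  show "integrable M (\<lambda>\<omega>. z k \<omega> \<bullet> z k \<omega>)" unfolding zz using int by simp
  have "(\<integral>\<omega>. z k \<omega> \<bullet> z k \<omega> \<partial>M) = (\<Sum>i<m. \<integral>\<omega>. (row C i \<bullet> ?x \<omega>)\<^sup>2 \<partial>M)"
    unfolding zz by (intro Bochner_Integration.integral_sum int)
  also have "\<dots> \<le> (\<Sum>i<m. row C i \<bullet> (P *\<^sub>v row C i))"
    using C by (intro sum_mono noisy_traj_second_moment_le lyap P_ge) auto
  finally show "(\<integral>\<omega>. z k \<omega> \<bullet> z k \<omega> \<partial>M) \<le> (\<Sum>i<m. row C i \<bullet> (P *\<^sub>v row C i))" .
qed

end

text \<open>The bound \<open>c\<close> on the output energy holds at every time, for every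
  scheduling sequence and every noise. It therefore passes through the time average, the limit
  superior and the supremum.\<close>

lemma h2g_sq_le:
  fixes M :: "'w measure"
  assumes Acl: "\<And>p. p \<in> PP \<Longrightarrow> Acl p \<in> carrier_mat n n"
    and Cz: "\<And>p. p \<in> PP \<Longrightarrow> Cz p \<in> carrier_mat m n"
    and lyap: "\<And>p v. p \<in> PP \<Longrightarrow> v \<in> carrier_vec n \<Longrightarrow>
      (transpose_mat (Acl p) *\<^sub>v v) \<bullet> (P *\<^sub>v (transpose_mat (Acl p) *\<^sub>v v)) + v \<bullet> v \<le> v \<bullet> (P *\<^sub>v v)"
    and P_ge: "\<And>v. v \<in> carrier_vec n \<Longrightarrow> v \<bullet> v \<le> v \<bullet> (P *\<^sub>v v)"
    and out: "\<And>p. p \<in> PP \<Longrightarrow> (\<Sum>i<m. row (Cz p) i \<bullet> (P *\<^sub>v row (Cz p) i)) \<le> c"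
  shows "h2g_sq M n PP Acl Cz \<le> ereal c"
  unfolding h2g_sq_def
proof (rule SUP_least, clarsimp simp only: mem_Collect_eq case_prod_conv fst_conv snd_conv)
  fix ps :: "nat \<Rightarrow> real Matrix.vec" and w assume ps: "\<forall>k. ps k \<in> PP" and w: "white_noise M n w"
  have psk: "ps k \<in> PP" for k using ps by blast
  let ?z = "\<lambda>k \<omega>. Cz (ps k) *\<^sub>v noisy_traj n (\<lambda>j. Acl (ps j)) w k \<omega>"
  have int: "integrable M (\<lambda>\<omega>. ?z k \<omega> \<bullet> ?z k \<omega>)" for k
    by (rule output_energy(1)[OF w Acl[OF psk] lyap[OF psk] P_ge Cz[OF psk]])
  have le: "(\<integral>\<omega>. ?z k \<omega> \<bullet> ?z k \<omega> \<partial>M) \<le> c" for k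
  proof -
    have "(\<integral>\<omega>. ?z k \<omega> \<bullet> ?z k \<omega> \<partial>M) \<le> (\<Sum>i<m. row (Cz (ps k)) i \<bullet> (P *\<^sub>v row (Cz (ps k)) i))"
      by (rule output_energy(2)[OF w Acl[OF psk] lyap[OF psk] P_ge Cz[OF psk]])
    also have "\<dots> \<le> c" by (rule out[OF psk])
    finally show ?thesis .
  qed
  let ?E = "\<lambda>N. \<integral>\<omega>. (1 / real N) * (\<Sum>k\<le>N. ?z k \<omega> \<bullet> ?z k \<omega>) \<partial>M"
  have E: "?E N \<le> (1 / real N) * (real (Suc N) * c)" for N
  proof -
    have "?E N = (1 / real N) * (\<Sum>k\<le>N. \<integral>\<omega>. ?z k \<omega> \<bullet> ?z k \<omega> \<partial>M)"
      by (simp only: integral_mult_right_zero Bochner_Integration.integral_sum[OF int])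
    also have "(\<Sum>k\<le>N. \<integral>\<omega>. ?z k \<omega> \<bullet> ?z k \<omega> \<partial>M) \<le> (\<Sum>k\<le>N. c)"
      by (intro sum_mono le)
    also have "(\<Sum>k\<le>N. c) = real (Suc N) * c" by simp
    finally show ?thesis by (simp add: mult_left_mono divide_right_mono)
  qed
  \<comment> \<open>The average has \<open>N + 1\<close> terms but is divided by \<open>N\<close>,
    so \<open>c\<close> is reached only in the limit. At \<open>N = 0\<close> the quotient is 0 by
    convention, which the limit superior does not see.\<close>
  have lim: "(\<lambda>N. (1 / real N) * (real (Suc N) * c)) \<longlonglongrightarrow> c"
  proof -
    have "(\<lambda>N. c * (real (Suc N) / real N)) \<longlonglongrightarrow> c * 1"
      by (intro tendsto_intros LIMSEQ_Suc_n_over_n)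
    thus ?thesis by (simp add: field_simps)
  qed
  have "limsup (\<lambda>N. ereal (?E N)) \<le> limsup (\<lambda>N. ereal ((1 / real N) * (real (Suc N) * c)))"
    using E by (intro Limsup_mono always_eventually) auto
  also have "\<dots> = ereal c"
    using lim by (intro lim_imp_Limsup) auto
  finally show "limsup (\<lambda>N. ereal (\<integral>\<omega>. (1 / real N) * (\<Sum>k\<le>N. let z = ?z k \<omega> in z \<bullet> z) \<partial>M)) \<le> ereal c"
    by (simp add: Let_def)
qed

subsection \<open>The matrix inequalities\<close>

lemma mult_hcat_vec:
  assumes "dim_row A = dim_row B" "dim_vec a = dim_col A" "dim_vec b = dim_col B"
  shows "hcat A B *\<^sub>v (a @\<^sub>v b) = A *\<^sub>v a + B *\<^sub>v b"
proof (rule eq_vecI)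
  fix i assume i: "i < dim_vec (A *\<^sub>v a + B *\<^sub>v b)"
  have "(hcat A B *\<^sub>v (a @\<^sub>v b)) $ i = (\<Sum>k<dim_col A + dim_col B. hcat A B $$ (i,k) * (a @\<^sub>v b) $ k)"
    using i assms by (simp add: scalar_prod_def atLeast0LessThan)
  also have "\<dots> = (\<Sum>k<dim_col A. A $$ (i,k) * a $ k) + (\<Sum>k<dim_col B. B $$ (i,k) * b $ k)"
    unfolding sum_lessThan_add using i assms
    by (intro arg_cong2[of _ _ _ _ "(+)"] sum.cong) (auto simp: hcat_def)
  also have "\<dots> = (A *\<^sub>v a + B *\<^sub>v b) $ i"
    using i assms by (simp add: scalar_prod_def atLeast0LessThan)
  finally show "(hcat A B *\<^sub>v (a @\<^sub>v b)) $ i = (A *\<^sub>v a + B *\<^sub>v b) $ i" .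
qed (use assms in auto)

lemma vcat_mult_vec:
  assumes "dim_col A = dim_col B"
  shows "vcat A B *\<^sub>v v = (A *\<^sub>v v) @\<^sub>v (B *\<^sub>v v)"
proof (rule eq_vecI)
  fix i assume "i < dim_vec ((A *\<^sub>v v) @\<^sub>v (B *\<^sub>v v))"
  with row_vcat[OF assms, of i] show "(vcat A B *\<^sub>v v) $ i = ((A *\<^sub>v v) @\<^sub>v (B *\<^sub>v v)) $ i"
    by auto
qed auto

lemma four_block_quad_form:
  fixes A B D :: "real mat"
  assumes A: "A \<in> carrier_mat m m" and B: "B \<in> carrier_mat m n" and D: "D \<in> carrier_mat n n"
    and a: "a \<in> carrier_vec m" and b: "b \<in> carrier_vec n"
  shows "(a @\<^sub>v b) \<bullet> (four_block_mat A B (transpose_mat B) D *\<^sub>v (a @\<^sub>v b)) =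
    a \<bullet> (A *\<^sub>v a) + 2 * (a \<bullet> (B *\<^sub>v b)) + b \<bullet> (D *\<^sub>v b)"
proof -
  have Aa: "A *\<^sub>v a \<in> carrier_vec m" and Bb: "B *\<^sub>v b \<in> carrier_vec m"
    and Ba: "transpose_mat B *\<^sub>v a \<in> carrier_vec n" and Db: "D *\<^sub>v b \<in> carrier_vec n"
    using A B D a b by auto
  have "four_block_mat A B (transpose_mat B) D *\<^sub>v (a @\<^sub>v b) =
      (A *\<^sub>v a + B *\<^sub>v b) @\<^sub>v (transpose_mat B *\<^sub>v a + D *\<^sub>v b)"
    using A B D a b by (simp add: four_block_eq vcat_mult_vec mult_hcat_vec)
  hence "(a @\<^sub>v b) \<bullet> (four_block_mat A B (transpose_mat B) D *\<^sub>v (a @\<^sub>v b)) =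
      a \<bullet> (A *\<^sub>v a + B *\<^sub>v b) + b \<bullet> (transpose_mat B *\<^sub>v a + D *\<^sub>v b)"
    using scalar_prod_append[OF a b, of "A *\<^sub>v a + B *\<^sub>v b" "transpose_mat B *\<^sub>v a + D *\<^sub>v b"] Aa Bb Ba Db by simp
  also have "\<dots> = a \<bullet> (A *\<^sub>v a) + a \<bullet> (B *\<^sub>v b) + (b \<bullet> (transpose_mat B *\<^sub>v a) + b \<bullet> (D *\<^sub>v b))"
    unfolding scalar_prod_add_distrib[OF a Aa Bb] scalar_prod_add_distrib[OF b Ba Db] ..
  also have "b \<bullet> (transpose_mat B *\<^sub>v a) = a \<bullet> (B *\<^sub>v b)"
    using adjoint_scalar_prod[OF B a b] comm_scalar_prod[OF b Ba] by simp
  finally show ?thesis by simp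
qed

lemma congruence_scalar_prod:
  fixes G M :: "real mat"
  assumes "G \<in> carrier_mat r c" "M \<in> carrier_mat r r" "v \<in> carrier_vec c" "w \<in> carrier_vec c"
  shows "v \<bullet> ((transpose_mat G * M * G) *\<^sub>v w) = (G *\<^sub>v v) \<bullet> (M *\<^sub>v (G *\<^sub>v w))"
proof -
  have "(transpose_mat G * M * G) *\<^sub>v w = transpose_mat G *\<^sub>v (M *\<^sub>v (G *\<^sub>v w))"
    using assms by (simp add: assoc_mult_mat_vec[of _ c r _ c] assoc_mult_mat_vec[of _ c r _ r])
  thus ?thesis
    using adjoint_scalar_prod[of "transpose_mat G" c r v "M *\<^sub>v (G *\<^sub>v w)"] assms by simp
qed

text \<open>Associativity conditioned on equations between dimensions. These are decided by
  \<open>simp\<close>, so the rule can be used for rewriting.\<close>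

lemma mat_assoc:
  fixes A :: "real mat"
  assumes "dim_col A = dim_row B" "dim_col B = dim_row C"
  shows "A * B * C = A * (B * C)"
  by (rule assoc_mult_mat[of A "dim_row A" "dim_col A" B "dim_col B" C "dim_col C"])
    (intro carrier_matI; simp only: assms)+

lemma mat_vec_assoc:
  fixes A :: "real mat"
  assumes "dim_col A = dim_row B" "dim_col B = dim_vec v"
  shows "A * B *\<^sub>v v = A *\<^sub>v (B *\<^sub>v v)"
  by (rule assoc_mult_mat_vec[of A "dim_row A" "dim_col A" B "dim_col B"])
    (intro carrier_matI carrier_vecI; simp only: assms)+

lemma add_zero_mat:
  fixes A :: "real mat"
  assumes "dim_row A = r" "dim_col A = c"
  shows "0\<^sub>m r c + A = A" "A + 0\<^sub>m r c = A"
  using assms by (auto intro!: eq_matI)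

lemma kron_one_left: "kron (1\<^sub>m 1) X = X"
  by (rule eq_matI) (auto simp: kron_def div_mod_less)

text \<open>Reading \<open>X\<close> as the Kronecker product of the 1-by-1 identity with
  \<open>X\<close> makes the mixed-product rule applicable.\<close>

lemma kron_colv_one_mult:
  assumes "n = dim_row X"
  shows "kron (colv p) (1\<^sub>m n) * X = kron (colv p) X"
proof -
  have "kron (colv p) (1\<^sub>m n) * X = kron (colv p) (1\<^sub>m n) * kron (1\<^sub>m 1) X"
    by (simp only: kron_one_left)
  also have "\<dots> = kron (colv p * 1\<^sub>m 1) (1\<^sub>m n * X)"
    using assms by (intro kron_mult) auto
  also have "\<dots> = kron (colv p) X" using assms by simp
  finally show ?thesis .
qed

lemma kron_one_mult_colv:
  assumes "dim_vec p = np" "dim_col Y = dim_row X"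
  shows "kron (1\<^sub>m np) Y * kron (colv p) X = kron (colv p) (Y * X)"
  using assms by (subst kron_mult) simp_all

lemma kron_colv_mult_vec:
  assumes "dim_vec x = n"
  shows "kron (colv p) (1\<^sub>m n) *\<^sub>v x = kronv p x"
proof (rule eq_vecI)
  fix i assume "i < dim_vec (kronv p x)"
  hence i: "i < dim_vec p * n" using assms by (simp add: kronv_def)
  have "(kron (colv p) (1\<^sub>m n) *\<^sub>v x) $ i = (\<Sum>k<n. kron (colv p) (1\<^sub>m n) $$ (i,k) * x $ k)"
    using i assms by (simp add: scalar_prod_def atLeast0LessThan)
  also have "\<dots> = (\<Sum>k<n. if k = i mod n then p $ (i div n) * x $ k else 0)"
    using i by (intro sum.cong) (auto simp: kron_def colv_def div_mod_less)
  also have "\<dots> = kronv p x $ i"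
    using i assms by (simp add: div_mod_less kronv_def)
  finally show "(kron (colv p) (1\<^sub>m n) *\<^sub>v x) $ i = kronv p x $ i" .
qed (use assms in \<open>simp add: kronv_def\<close>)

lemma blkdiag_mult_vcat:
  assumes "dim_col A = dim_row C" "dim_col B = dim_row D" "dim_col C = dim_col D"
  shows "blkdiag A B * vcat C D = vcat (A * C) (B * D)"
proof -
  have "blkdiag A B * vcat C D = vcat (A * C + 0\<^sub>m (dim_row A) (dim_col B) * D) (0\<^sub>m (dim_row B) (dim_col A) * C + B * D)"
    using assms by (simp add: blkdiag_eq vcat_mult hcat_mult_vcat)
  also have "\<dots> = vcat (A * C) (B * D)"
    using assms by (intro arg_cong2[of _ _ _ _ vcat]) (auto intro!: eq_matI)
  finally show ?thesis .
qed

lemma transpose_blkdiag: "transpose_mat (blkdiag A B) = blkdiag (transpose_mat A) (transpose_mat B)"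
  by (intro eq_matI) (auto simp: blkdiag_def)

lemma uminus_minus_mat:
  fixes A :: "real mat"
  assumes "A \<in> carrier_mat r c" "B \<in> carrier_mat r c"
  shows "- (A - B) = B - A"
  using assms by (intro eq_matI) auto

lemma pos_def_form_nonneg:
  assumes "pos_def M" "M \<in> carrier_mat n n" "x \<in> carrier_vec n"
  shows "0 \<le> x \<bullet> (M *\<^sub>v x)"
proof (cases "x = 0\<^sub>v n")
  case True
  have "M *\<^sub>v 0\<^sub>v n \<in> carrier_vec n" using mult_mat_vec_carrier[OF assms(2) zero_carrier_vec] .
  thus ?thesis unfolding True by simp
next
  case False
  thus ?thesis using assms unfolding pos_def_def by (metis carrier_matD(1) less_imp_le)
qed

text \<open>The dimensions are put in the order \<open>np * (2 * nx)\<close> that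
  \<open>kron\<close> produces, so that they match syntactically in all later products.\<close>

lemma L_dims:
  "L11 nx np \<in> carrier_mat (np * (2 * nx)) (np * (2 * nx))"
  "L12 nx np \<in> carrier_mat (np * (2 * nx)) (2 * nx)"
  "L21 nx np \<in> carrier_mat (nx + (np * nx + (nx + np * nx))) (np * (2 * nx))"
  "L22 nx np \<in> carrier_mat (nx + (np * nx + (nx + np * nx))) (2 * nx)"
  by (auto simp: L11_def L12_def L21_def L22_def)

lemma Delta_carrier: "Delta nx np p \<in> carrier_mat (np * (2 * nx)) (np * (2 * nx))"
  by (auto simp: Delta_def mat_diag_def)

text \<open>On the vector consisting of \<open>p \<otimes> v\<close> and \<open>v\<close> the
  scheduling channel is closed: the outer factor of the multiplier yields \<open>L12 v\<close> over
  \<open>p \<otimes> v\<close>, which is \<open>L12 v\<close> over \<open>Delta\<close> applied to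
  it. The multiplier term is thus a value of the form in the second condition, and the first
  condition bounds it by the form of \<open>W\<close>.\<close>

lemma full_block_lmi_nonneg:
  assumes lmi: "full_block_lmi PP (Delta nx np) W (L11 nx np) (L12 nx np) (L21 nx np) (L22 nx np) Xi"
    and p: "p \<in> PP" "dim_vec p = np"
    and Xi: "Xi \<in> carrier_mat (4 * np * nx) (4 * np * nx)"
    and W: "W \<in> carrier_mat (nx + (np * nx + (nx + np * nx))) (nx + (np * nx + (nx + np * nx)))"
    and v: "v \<in> carrier_vec (2 * nx)"
  defines "y \<equiv> (L21 nx np * kron (colv p) (1\<^sub>m (2 * nx)) + L22 nx np) *\<^sub>v v"
  shows "y \<bullet> (W *\<^sub>v y) \<ge> 0"
proof -
  let ?d = "np * (2 * nx)" and ?N = "nx + (np * nx + (nx + np * nx))"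
  let ?E = "kron (colv p) (1\<^sub>m (2 * nx))"
  let ?T = "four_block_mat (L11 nx np) (L12 nx np) (1\<^sub>m ?d) (0\<^sub>m ?d (2 * nx))"
  let ?B = "hcat (L21 nx np) (L22 nx np)"
  let ?V = "vcat (1\<^sub>m ?d) (Delta nx np p)"
  let ?Z = "vcat ?E (1\<^sub>m (2 * nx))"
  note dims = L_dims[of nx np, THEN carrier_matD(1)] L_dims[of nx np, THEN carrier_matD(2)]
  note Ddims = carrier_matD[OF Delta_carrier[of nx np p]]
  have Xi': "Xi \<in> carrier_mat (?d + ?d) (?d + ?d)" using Xi by (simp add: mult_ac)
  have T: "?T \<in> carrier_mat (?d + ?d) (?d + 2 * nx)"
    and B: "?B \<in> carrier_mat ?N (?d + 2 * nx)"
    and V: "?V \<in> carrier_mat (?d + ?d) ?d"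
    and Z: "?Z \<in> carrier_mat (?d + 2 * nx) (2 * nx)"
    and E: "?E \<in> carrier_mat ?d (2 * nx)"
    using dims Ddims p by (auto intro!: carrier_matI)
  have lmi1: "neg_def (transpose_mat ?T * Xi * ?T - transpose_mat ?B * W * ?B)"
    and lmi2: "pos_semidef (transpose_mat ?V * Xi * ?V)"
    using lmi p dims Ddims by (auto simp: full_block_lmi_def Let_def)
  have TZ: "?T * ?Z = vcat (L12 nx np) ?E"
  proof -
    have "?T = vcat (hcat (L11 nx np) (L12 nx np)) (hcat (1\<^sub>m ?d) (0\<^sub>m ?d (2 * nx)))"
      using dims by (intro four_block_eq) auto
    hence "?T * ?Z = vcat (L11 nx np * ?E + L12 nx np * 1\<^sub>m (2 * nx)) (1\<^sub>m ?d * ?E + 0\<^sub>m ?d (2 * nx) * 1\<^sub>m (2 * nx))"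
      using dims p by (simp add: vcat_mult hcat_mult_vcat)
    also have "L11 nx np * ?E + L12 nx np * 1\<^sub>m (2 * nx) = L12 nx np"
      using E L_dims(2)[of nx np] by (auto simp: L11_def mult_ac intro!: eq_matI)
    also have "1\<^sub>m ?d * ?E + 0\<^sub>m ?d (2 * nx) * 1\<^sub>m (2 * nx) = ?E"
      using E left_mult_one_mat[OF E] by (auto intro!: eq_matI)
    finally show ?thesis .
  qed
  \<comment> \<open>A diagonal matrix applied to the all-ones vector returns its diagonal. This
    identity puts the image of \<open>?Z\<close> under \<open>?T\<close> into the range of
    \<open>?V\<close>, the only place where the second condition gives information.\<close>
  have DL: "Delta nx np p * L12 nx np = ?E"
  proof -
    have "mat_diag np (\<lambda>i. p $ i) * ones np = colv p"
      using p mat_diag_mult_left[of "ones np" np 1 "\<lambda>i. p $ i"]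
      by (auto simp: ones_def colv_def intro!: eq_matI)
    thus ?thesis unfolding Delta_def L12_def by (subst kron_mult) (auto simp: mat_diag_def)
  qed
  have VL: "?V * L12 nx np = vcat (L12 nx np) ?E"
    using Ddims left_mult_one_mat[OF L_dims(2)[of nx np]] by (simp add: vcat_mult DL)
  let ?x = "?Z *\<^sub>v v"
  have x: "?x \<in> carrier_vec (?d + 2 * nx)" using mult_mat_vec_carrier[OF Z v] .
  have Lv: "L12 nx np *\<^sub>v v \<in> carrier_vec ?d" using mult_mat_vec_carrier[OF L_dims(2) v] .
  have Tx: "?T *\<^sub>v ?x = ?V *\<^sub>v (L12 nx np *\<^sub>v v)"
    using assoc_mult_mat_vec[OF T Z v] assoc_mult_mat_vec[OF V L_dims(2) v] TZ VL by simp
  have Bx: "?B *\<^sub>v ?x = y"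
  proof -
    have "?B * ?Z = L21 nx np * ?E + L22 nx np * 1\<^sub>m (2 * nx)"
      using dims p by (intro hcat_mult_vcat) auto
    also have "\<dots> = L21 nx np * ?E + L22 nx np" using L_dims(4)[of nx np] by simp
    finally show ?thesis using assoc_mult_mat_vec[OF B Z v] by (simp add: y_def)
  qed
  let ?M1 = "transpose_mat ?T * Xi * ?T" and ?M2 = "transpose_mat ?B * W * ?B"
  have M1: "?M1 \<in> carrier_mat (?d + 2 * nx) (?d + 2 * nx)" and M2: "?M2 \<in> carrier_mat (?d + 2 * nx) (?d + 2 * nx)"
    using T B by (auto intro!: carrier_matI)
  have "0 \<le> ?x \<bullet> ((- (?M1 - ?M2)) *\<^sub>v ?x)"
    by (rule pos_def_form_nonneg[OF lmi1[unfolded neg_def_def] _ x])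
      (simp only: uminus_carrier_iff_mat minus_carrier_mat[OF M2])
  also have "(- (?M1 - ?M2)) *\<^sub>v ?x = ?M2 *\<^sub>v ?x - ?M1 *\<^sub>v ?x"
  proof -
    have "- (?M1 - ?M2) = ?M2 - ?M1" by (rule uminus_minus_mat[OF M1 M2])
    thus ?thesis using minus_mult_distrib_mat_vec[OF M2 M1 x] by simp
  qed
  also have "?x \<bullet> (?M2 *\<^sub>v ?x - ?M1 *\<^sub>v ?x) = ?x \<bullet> (?M2 *\<^sub>v ?x) - ?x \<bullet> (?M1 *\<^sub>v ?x)"
    by (rule scalar_prod_minus_distrib[OF x]) (use mult_mat_vec_carrier[OF M1 x] mult_mat_vec_carrier[OF M2 x] in auto)
  also have "?x \<bullet> (?M2 *\<^sub>v ?x) = y \<bullet> (W *\<^sub>v y)"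
    using congruence_scalar_prod[OF B W x x] Bx by simp
  also have "?x \<bullet> (?M1 *\<^sub>v ?x) = (?V *\<^sub>v (L12 nx np *\<^sub>v v)) \<bullet> (Xi *\<^sub>v (?V *\<^sub>v (L12 nx np *\<^sub>v v)))"
    using congruence_scalar_prod[OF T Xi' x x] Tx by simp
  also have "\<dots> = (L12 nx np *\<^sub>v v) \<bullet> ((transpose_mat ?V * Xi * ?V) *\<^sub>v (L12 nx np *\<^sub>v v))"
    by (rule congruence_scalar_prod[OF V Xi' Lv Lv, symmetric])
  finally have ineq: "(L12 nx np *\<^sub>v v) \<bullet> ((transpose_mat ?V * Xi * ?V) *\<^sub>v (L12 nx np *\<^sub>v v)) \<le> y \<bullet> (W *\<^sub>v y)"
    by simp
  have "dim_row (transpose_mat ?V * Xi * ?V) = ?d" using V by simp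
  hence "0 \<le> (L12 nx np *\<^sub>v v) \<bullet> ((transpose_mat ?V * Xi * ?V) *\<^sub>v (L12 nx np *\<^sub>v v))"
    using lmi2 Lv unfolding pos_semidef_def by metis
  with ineq show ?thesis by linarith
qed

text \<open>With the channel closed, \<open>L21\<close> contributes the copies
  \<open>p \<otimes> v1\<close> and \<open>p \<otimes> v2\<close>, and \<open>L22\<close>
  contributes \<open>v1\<close> and \<open>v2\<close>. The blocks come out in the order in which
  \<open>Wmat\<close> expects them.\<close>

lemma L_mult_append:
  assumes p: "dim_vec p = np" and v: "v1 \<in> carrier_vec nx" "v2 \<in> carrier_vec nx"
  defines "G \<equiv> vcat (1\<^sub>m nx) (kron (colv p) (1\<^sub>m nx))"
  shows "(L21 nx np * kron (colv p) (1\<^sub>m (2 * nx)) + L22 nx np) *\<^sub>v (v1 @\<^sub>v v2) = (G *\<^sub>v v1) @\<^sub>v (G *\<^sub>v v2)"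
proof -
  let ?E = "kron (colv p) (1\<^sub>m (2 * nx))"
  let ?J1 = "hcat (1\<^sub>m nx) (0\<^sub>m nx nx)" and ?J2 = "hcat (0\<^sub>m nx nx) (1\<^sub>m nx)"
  have kJ: "kron (1\<^sub>m np) J * ?E = kron (colv p) J" if "dim_row J = nx" "dim_col J = 2 * nx" for J
    using that p by (subst kron_one_mult_colv) auto
  have "L21 nx np * ?E = vcat (0\<^sub>m nx (2 * nx)) (vcat (kron (colv p) ?J1) (vcat (0\<^sub>m nx (2 * nx)) (kron (colv p) ?J2)))"
    using p kJ by (simp add: L21_def vcat_mult)
  moreover have "L22 nx np = vcat ?J1 (vcat (0\<^sub>m (np * nx) (2 * nx)) (vcat ?J2 (0\<^sub>m (np * nx) (2 * nx))))"
    by (simp add: L22_def kron_zero_right)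
  ultimately have "L21 nx np * ?E + L22 nx np =
      vcat ?J1 (vcat (kron (colv p) ?J1) (vcat ?J2 (kron (colv p) ?J2)))"
    using p by (simp add: vcat_add add_zero_mat)
  moreover have "kron (colv p) J *\<^sub>v v = kron (colv p) (1\<^sub>m nx) *\<^sub>v (J *\<^sub>v v)"
    if "dim_row J = nx" "dim_col J = dim_vec v" for J v
    using that kron_colv_one_mult[of nx J p] mat_vec_assoc[of "kron (colv p) (1\<^sub>m nx)" J v] by simp
  moreover have "?J1 *\<^sub>v (v1 @\<^sub>v v2) = v1" "?J2 *\<^sub>v (v1 @\<^sub>v v2) = v2"
    using v by (subst mult_hcat_vec; auto)+
  moreover have "dim_vec (v1 @\<^sub>v v2) = 2 * nx" using v by simp
  ultimately have "(L21 nx np * ?E + L22 nx np) *\<^sub>v (v1 @\<^sub>v v2) =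
      v1 @\<^sub>v (kron (colv p) (1\<^sub>m nx) *\<^sub>v v1) @\<^sub>v v2 @\<^sub>v (kron (colv p) (1\<^sub>m nx) *\<^sub>v v2)"
    by (simp add: vcat_mult_vec)
  also have "\<dots> = (v1 @\<^sub>v (kron (colv p) (1\<^sub>m nx) *\<^sub>v v1)) @\<^sub>v v2 @\<^sub>v (kron (colv p) (1\<^sub>m nx) *\<^sub>v v2)"
    by (intro eq_vecI) auto
  also have "\<dots> = (G *\<^sub>v v1) @\<^sub>v (G *\<^sub>v v2)"
    using v unfolding G_def by (subst (1 2) vcat_mult_vec) auto
  finally show ?thesis .
qed

section \<open>From the data matrices to the closed loop\<close>

lemma mult_mat_of_cols:
  assumes "M \<in> carrier_mat r n" "\<And>v. v \<in> set vs \<Longrightarrow> v \<in> carrier_vec n"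
  shows "M * mat_of_cols n vs = mat_of_cols r (map (\<lambda>v. M *\<^sub>v v) vs)"
proof (rule eq_matI)
  fix i j assume "i < dim_row (mat_of_cols r (map (\<lambda>v. M *\<^sub>v v) vs))"
    "j < dim_col (mat_of_cols r (map (\<lambda>v. M *\<^sub>v v) vs))"
  hence ij: "i < r" "j < length vs" by simp_all
  have "col (mat_of_cols n vs) j = vs ! j" using ij assms(2) by (intro col_mat_of_cols) auto
  thus "(M * mat_of_cols n vs) $$ (i,j) = mat_of_cols r (map (\<lambda>v. M *\<^sub>v v) vs) $$ (i,j)"
    using ij assms(1) by (simp add: mat_of_cols_index)
qed (use assms in auto)

lemma kronv_dim [simp]: "dim_vec (kronv p x) = dim_vec p * dim_vec x"
  by (simp add: kronv_def)

lemma aff_mult_vec: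
  assumes "\<forall>i\<le>np. M i \<in> carrier_mat r n" "dim_vec p = np" "x \<in> carrier_vec n"
  shows "aff M np p *\<^sub>v x = M 0 *\<^sub>v x + hblocks M r np n *\<^sub>v kronv p x"
proof -
  have "aff M np p *\<^sub>v x = M 0 *\<^sub>v x + (hblocks M r np n * kron (colv p) (1\<^sub>m n)) *\<^sub>v x"
    unfolding aff_hblocks[OF assms(1,2)]
    by (rule add_mult_distrib_mat_vec[of _ r n]) (use assms in \<open>auto intro!: carrier_matI\<close>)
  also have "(hblocks M r np n * kron (colv p) (1\<^sub>m n)) *\<^sub>v x = hblocks M r np n *\<^sub>v kronv p x"
    using assms kron_colv_mult_vec[of x n p] by (subst mat_vec_assoc) auto
  finally show ?thesis .
qed

text \<open>The link between data and unknown coefficients: each column is one instance of the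
  system equation, with the affine matrices expanded so that the scheduling moves into the Kronecker
  products stored in \<open>dataDp\<close>.\<close>

lemma dataXplus_eq:
  assumes A: "\<forall>i\<le>np. A i \<in> carrier_mat nx nx" and B: "\<forall>i\<le>np. B i \<in> carrier_mat nx nu"
    and dims: "\<And>k. 1 \<le> k \<Longrightarrow> k \<le> Nd \<Longrightarrow>
      xd k \<in> carrier_vec nx \<and> ud k \<in> carrier_vec nu \<and> pd k \<in> carrier_vec np"
    and traj: "\<And>k. 1 \<le> k \<Longrightarrow> k < Nd \<Longrightarrow>
      xd (Suc k) = aff A np (pd k) *\<^sub>v xd k + aff B np (pd k) *\<^sub>v ud k"
  shows "dataXplus nx Nd xd =
    hcat (A 0) (hcat (hblocks A nx np nx) (hcat (B 0) (hblocks B nx np nu))) * dataDp nx nu np Nd ud pd xd"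
proof -
  let ?Ab = "hblocks A nx np nx" and ?Bb = "hblocks B nx np nu"
  let ?ks = "[1..<Nd]"
  have carr: "A 0 \<in> carrier_mat nx nx" "B 0 \<in> carrier_mat nx nu"
    "?Ab \<in> carrier_mat nx (np * nx)" "?Bb \<in> carrier_mat nx (np * nu)"
    using A B by (auto intro: carrier_matI)
  have dv: "dim_vec (xd k) = nx" "dim_vec (ud k) = nu" "dim_vec (pd k) = np" if "Suc 0 \<le> k" "k < Nd" for k
    using dims[of k] that by auto
  note carrD = carr[THEN carrier_matD(1)] carr[THEN carrier_matD(2)]
  have len: "dim_col (dataX nx Nd xd) = Nd - 1" "dim_col (dataXp np nx Nd pd xd) = Nd - 1"
    "dim_col (dataU nu Nd ud) = Nd - 1" "dim_col (dataUp np nu Nd pd ud) = Nd - 1"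
    "dim_row (dataX nx Nd xd) = nx" "dim_row (dataXp np nx Nd pd xd) = np * nx"
    "dim_row (dataU nu Nd ud) = nu" "dim_row (dataUp np nu Nd pd ud) = np * nu"
    by (simp_all add: dataX_def dataXp_def dataU_def dataUp_def)
  have "hcat (A 0) (hcat ?Ab (hcat (B 0) ?Bb)) * dataDp nx nu np Nd ud pd xd =
      A 0 * dataX nx Nd xd + (?Ab * dataXp np nx Nd pd xd + (B 0 * dataU nu Nd ud + ?Bb * dataUp np nu Nd pd ud))"
    using len carrD by (simp add: dataDp_def hcat_mult_vcat)
  also have "A 0 * dataX nx Nd xd = mat_of_cols nx (map (\<lambda>k. A 0 *\<^sub>v xd k) ?ks)"
    unfolding dataX_def using dims by (subst mult_mat_of_cols[OF carr(1)]) (auto simp: o_def)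
  also have "B 0 * dataU nu Nd ud = mat_of_cols nx (map (\<lambda>k. B 0 *\<^sub>v ud k) ?ks)"
    unfolding dataU_def using dims by (subst mult_mat_of_cols[OF carr(2)]) (auto simp: o_def)
  also have "?Ab * dataXp np nx Nd pd xd = mat_of_cols nx (map (\<lambda>k. ?Ab *\<^sub>v kronv (pd k) (xd k)) ?ks)"
    unfolding dataXp_def 
    by (subst mult_mat_of_cols[OF carr(3)]) (auto simp: o_def dv intro!: carrier_vecI)
  also have "?Bb * dataUp np nu Nd pd ud = mat_of_cols nx (map (\<lambda>k. ?Bb *\<^sub>v kronv (pd k) (ud k)) ?ks)"
    unfolding dataUp_def 
    by (subst mult_mat_of_cols[OF carr(4)]) (auto simp: o_def dv intro!: carrier_vecI)
  finally have eq: "hcat (A 0) (hcat ?Ab (hcat (B 0) ?Bb)) * dataDp nx nu np Nd ud pd xd =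
      mat_of_cols nx (map (\<lambda>k. A 0 *\<^sub>v xd k) ?ks) + (mat_of_cols nx (map (\<lambda>k. ?Ab *\<^sub>v kronv (pd k) (xd k)) ?ks) +
      (mat_of_cols nx (map (\<lambda>k. B 0 *\<^sub>v ud k) ?ks) + mat_of_cols nx (map (\<lambda>k. ?Bb *\<^sub>v kronv (pd k) (ud k)) ?ks)))" .
  show ?thesis
    unfolding eq
  proof (rule eq_matI; simp add: dataXplus_def del: upt_Suc)
    fix i j assume i: "i < nx" and j: "j < Nd - Suc 0"
    \<comment> \<open>Columns are numbered from 0 and samples from 1. Column \<open>j\<close> of the
      shifted data holds the successor of sample \<open>Suc j\<close>.\<close>
    let ?k = "Suc j"
    have k: "1 \<le> ?k" "?k < Nd" using j by auto
    have d: "xd ?k \<in> carrier_vec nx" "ud ?k \<in> carrier_vec nu" "dim_vec (pd ?k) = np"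
      using dims[of ?k] k by auto
    have "xd (Suc ?k) = (A 0 *\<^sub>v xd ?k + ?Ab *\<^sub>v kronv (pd ?k) (xd ?k)) +
        (B 0 *\<^sub>v ud ?k + ?Bb *\<^sub>v kronv (pd ?k) (ud ?k))"
      using traj[OF k] aff_mult_vec[OF A d(3,1)] aff_mult_vec[OF B d(3,2)] by simp
    hence "xd (Suc ?k) $ i = (A 0 *\<^sub>v xd ?k) $ i + ((?Ab *\<^sub>v kronv (pd ?k) (xd ?k)) $ i +
        ((B 0 *\<^sub>v ud ?k) $ i + (?Bb *\<^sub>v kronv (pd ?k) (ud ?k)) $ i))"
      using i carrD by simp
    thus "mat_of_cols nx (map xd [2..<Suc Nd]) $$ (i,j) =
      mat_of_cols nx (map (\<lambda>k. A 0 *\<^sub>v xd k) [Suc 0..<Nd]) $$ (i,j) +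
      (mat_of_cols nx (map (\<lambda>k. ?Ab *\<^sub>v kronv (pd k) (xd k)) [Suc 0..<Nd]) $$ (i,j) +
      (mat_of_cols nx (map (\<lambda>k. B 0 *\<^sub>v ud k) [Suc 0..<Nd]) $$ (i,j) +
       mat_of_cols nx (map (\<lambda>k. ?Bb *\<^sub>v kronv (pd k) (ud k)) [Suc 0..<Nd]) $$ (i,j)))"
      using i j by (subst (1 2 3 4 5) mat_of_cols_index) (auto simp del: upt_Suc)
  qed
qed

text \<open>The last block row explains the term quadratic in \<open>p\<close>: the scheduled input
  contains \<open>p\<close> times a gain that is itself affine in \<open>p\<close>. Its two blocks
  recombine into \<open>p \<otimes> Y(p)\<close>.\<close>

lemma lhs_block_mult:
  assumes P: "P \<in> carrier_mat nx nx" and Y: "Y0 \<in> carrier_mat nu nx" "Ybar \<in> carrier_mat nu (nx * np)"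
    and p: "dim_vec p = np"
  defines "E \<equiv> kron (colv p) (1\<^sub>m nx)"
  defines "Y \<equiv> Y0 + Ybar * E"
  shows "lhs_block nx nu np P Y0 Ybar * vcat (1\<^sub>m nx) (vcat E (kron (colv p) E)) =
    vcat P (vcat (kron (colv p) P) (vcat Y (kron (colv p) Y)))"
proof -
  have E: "dim_row E = np * nx" "dim_col E = nx" using p by (auto simp: E_def)
  have Yb: "dim_row Ybar = nu" "dim_col Ybar = np * nx" using Y by auto
  have kE: "kron (1\<^sub>m np) X * E = kron (colv p) X" if "dim_col X = nx" for X
    unfolding E_def using that p by (subst kron_one_mult_colv) auto
  have kkE: "kron (1\<^sub>m np) Ybar * kron (colv p) E = kron (colv p) (Ybar * E)"
    using p Yb E by (intro kron_one_mult_colv) auto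
  have "lhs_block nx nu np P Y0 Ybar * vcat (1\<^sub>m nx) (vcat E (kron (colv p) E)) =
      vcat P (vcat (kron (colv p) P) (vcat (Y0 + Ybar * E) (kron (colv p) Y0 + kron (colv p) (Ybar * E))))"
    using P Y(1) Yb p E kE[of P] kE[of Y0] kkE
    by (simp add: lhs_block_def vcat_mult hcat_mult_vcat add_zero_mat mult.commute[of nx np])
  also have "kron (colv p) Y0 + kron (colv p) (Ybar * E) = kron (colv p) Y"
    unfolding Y_def using Y(1) Yb E by (intro kron_add_right[symmetric]) auto
  finally show ?thesis by (simp add: Y_def)
qed

lemma hcat_affine:
  assumes "dim_row M0 = dim_row M" "dim_col M0 = n" "dim_col M = dim_vec p * n"
  shows "hcat M0 M * vcat (1\<^sub>m n) (kron (colv p) (1\<^sub>m n)) = M0 + M * kron (colv p) (1\<^sub>m n)"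
  using assms by (subst hcat_mult_vcat) auto

text \<open>This undoes the change of variables from gains to \<open>Y\<close>. The inverse of
  \<open>I \<otimes> P\<close> is \<open>I \<otimes> minv P\<close>, and it slides past
  \<open>p \<otimes> I\<close> to cancel the factor \<open>P\<close> on the right.\<close>

lemma gain_mult:
  assumes P: "P \<in> carrier_mat nx nx" "pos_def P"
    and Y: "Y0 \<in> carrier_mat nu nx" "Ybar \<in> carrier_mat nu (nx * np)" and p: "dim_vec p = np"
  defines "Kc \<equiv> \<lambda>i. if i = 0 then Y0 * minv P else colblock (Ybar * minv (kron (1\<^sub>m np) P)) (i - 1) nx"
  shows "aff Kc np p \<in> carrier_mat nu nx"
    and "aff Kc np p * P = Y0 + Ybar * kron (colv p) (1\<^sub>m nx)"
proof -
  let ?Pi = "minv P" and ?E = "kron (colv p) (1\<^sub>m nx)"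
  note Pi = pos_def_minv[OF P]
  have PiD: "dim_row ?Pi = nx" "dim_col ?Pi = nx" using Pi(1) by auto
  have PD: "dim_row P = nx" "dim_col P = nx" using P by auto
  have Yb: "dim_row Ybar = nu" "dim_col Ybar = np * nx" "dim_row Y0 = nu" "dim_col Y0 = nx" using Y by auto
  have kPi: "minv (kron (1\<^sub>m np) P) = kron (1\<^sub>m np) ?Pi"
  proof (rule minv_eq)
    show "kron (1\<^sub>m np) P \<in> carrier_mat (np * nx) (np * nx)" "kron (1\<^sub>m np) ?Pi \<in> carrier_mat (np * nx) (np * nx)"
      using PD PiD by (auto intro!: carrier_matI)
    show "kron (1\<^sub>m np) P * kron (1\<^sub>m np) ?Pi = 1\<^sub>m (np * nx)" "kron (1\<^sub>m np) ?Pi * kron (1\<^sub>m np) P = 1\<^sub>m (np * nx)"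
      using PD PiD Pi by (auto simp: kron_mult kron_one)
  qed
  have K: "aff Kc np p = Y0 * ?Pi + Ybar * kron (1\<^sub>m np) ?Pi * ?E"
    unfolding Kc_def kPi using p Yb PiD by (intro aff_colblock) auto
  show "aff Kc np p \<in> carrier_mat nu nx" unfolding K using Yb PiD p by (auto intro!: carrier_matI)
  have "aff Kc np p * P = Y0 * ?Pi * P + Ybar * kron (1\<^sub>m np) ?Pi * ?E * P"
    unfolding K by (rule add_mult_distrib_mat[of _ nu nx]) (use Yb PiD PD p in \<open>auto intro!: carrier_matI\<close>)
  also have "Y0 * ?Pi * P = Y0" using Yb PiD PD Pi(3) by (simp add: mat_assoc)
  also have "Ybar * kron (1\<^sub>m np) ?Pi * ?E * P = Ybar * (kron (1\<^sub>m np) ?Pi * (?E * P))"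
    using Yb PiD PD p by (simp add: mat_assoc)
  also have "kron (1\<^sub>m np) ?Pi * (?E * P) = ?E"
    using PiD PD p Pi(3) by (simp add: kron_colv_one_mult kron_one_mult_colv)
  finally show "aff Kc np p * P = Y0 + Ybar * ?E" .
qed

text \<open>The diagonal blocks of \<open>Wmat\<close> are zero outside their leading corner, where
  \<open>G\<close> is the identity, so the congruence leaves \<open>P - I\<close> and
  \<open>P\<close> free of \<open>p\<close>. The scheduling survives only in the off-diagonal
  block.\<close>

lemma Wmat_congruence:
  assumes P: "P \<in> carrier_mat nx nx" and X: "X \<in> carrier_mat nx m"
    and FQ: "FQ \<in> carrier_mat (m * (1 + np)) (nx * (1 + np))" and p: "dim_vec p = np"
    and v: "v1 \<in> carrier_vec nx" "v2 \<in> carrier_vec nx"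
  defines "G \<equiv> vcat (1\<^sub>m nx) (kron (colv p) (1\<^sub>m nx))"
    and "Gd \<equiv> vcat (1\<^sub>m m) (kron (colv p) (1\<^sub>m m))"
    and "W \<equiv> Wmat nx np P X FQ"
  shows "W \<in> carrier_mat (nx + (np * nx + (nx + np * nx))) (nx + (np * nx + (nx + np * nx)))"
    and "((G *\<^sub>v v1) @\<^sub>v (G *\<^sub>v v2)) \<bullet> (W *\<^sub>v ((G *\<^sub>v v1) @\<^sub>v (G *\<^sub>v v2))) =
      v1 \<bullet> ((P - 1\<^sub>m nx) *\<^sub>v v1) + 2 * (v1 \<bullet> (X * (transpose_mat Gd * FQ * G) *\<^sub>v v2)) + v2 \<bullet> (P *\<^sub>v v2)"
proof -
  let ?N = "nx + np * nx" and ?E = "kron (colv p) (1\<^sub>m nx)"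
  let ?Z = "0\<^sub>m (np * nx) (np * nx) :: real mat"
  let ?A = "blkdiag P ?Z - blkdiag (1\<^sub>m nx) ?Z" and ?D = "blkdiag P ?Z"
  let ?Xc = "blkdiag X (kron (1\<^sub>m np) X)"
  have PD: "dim_row P = nx" "dim_col P = nx" and XD: "dim_row X = nx" "dim_col X = m"
    and FQD: "dim_row FQ = m + np * m" "dim_col FQ = nx + np * nx"
    using P X FQ by auto
  have GD: "dim_row G = ?N" "dim_col G = nx" "dim_row Gd = m + np * m" "dim_col Gd = m"
    using p by (auto simp: G_def Gd_def)
  have A: "?A \<in> carrier_mat ?N ?N" and D: "?D \<in> carrier_mat ?N ?N"
    and B: "?Xc * FQ \<in> carrier_mat ?N ?N" and G: "G \<in> carrier_mat ?N nx"
    using PD XD FQD GD by (auto intro!: carrier_matI)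
  have W: "W = four_block_mat ?A (?Xc * FQ) (transpose_mat (?Xc * FQ)) ?D"
    by (simp add: W_def Wmat_def Let_def mult.commute[of nx np])
  show "W \<in> carrier_mat (nx + (np * nx + (nx + np * nx))) (nx + (np * nx + (nx + np * nx)))"
    unfolding W using four_block_carrier_mat[OF A D] by (simp add: add.assoc)
  have Gv: "G *\<^sub>v v1 \<in> carrier_vec ?N" "G *\<^sub>v v2 \<in> carrier_vec ?N"
    using mult_mat_vec_carrier[OF G] v by auto
  have diag: "transpose_mat G * blkdiag Q ?Z * G = Q" if "dim_row Q = nx" "dim_col Q = nx" for Q
  proof -
    have "blkdiag Q ?Z * G = vcat Q (0\<^sub>m (np * nx) nx)"
      unfolding G_def using that p by (simp add: blkdiag_mult_vcat)
    moreover have "transpose_mat G = hcat (1\<^sub>m nx) (transpose_mat ?E)"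
      unfolding G_def by (simp add: transpose_vcat)
    ultimately have "transpose_mat G * (blkdiag Q ?Z * G) = Q"
      using that p by (simp add: hcat_mult_vcat add_zero_mat)
    thus ?thesis using that GD by (simp add: mat_assoc)
  qed
  have A_eq: "?A = blkdiag (P - 1\<^sub>m nx) ?Z"
    using PD by (auto simp: blkdiag_def intro!: eq_matI)
  have GAG: "transpose_mat G * ?A * G = P - 1\<^sub>m nx"
    unfolding A_eq by (rule diag) (use PD in auto)
  \<comment> \<open>The block \<open>I \<otimes> X\<close> slides past \<open>p\<close>, which moves
    the scheduling factor from the state side to the data side. There \<open>FQ\<close> appears
    between exactly the two factors that also occur in its relation to \<open>FF\<close>.\<close>
  have GXc: "transpose_mat G * ?Xc = X * transpose_mat Gd"
  proof -
    have "transpose_mat ?Xc * G = vcat (transpose_mat X) (kron (colv p) (transpose_mat X))"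
      unfolding G_def using XD p
      by (simp add: transpose_blkdiag kron_transpose transpose_one blkdiag_mult_vcat kron_one_mult_colv)
    also have "\<dots> = Gd * transpose_mat X"
      unfolding Gd_def using XD by (simp add: vcat_mult kron_colv_one_mult)
    finally have eq: "transpose_mat ?Xc * G = Gd * transpose_mat X" .
    have "transpose_mat G * ?Xc = transpose_mat (transpose_mat ?Xc * G)"
      using GD XD by (subst transpose_mult[of _ "m + np * m" ?N G nx]) (auto intro!: carrier_matI)
    also have "\<dots> = X * transpose_mat Gd"
      unfolding eq using GD XD by (subst transpose_mult[of _ "m + np * m" m _ nx]) (auto intro!: carrier_matI)
    finally show ?thesis .
  qed
  have "transpose_mat G * (?Xc * FQ) * G = (transpose_mat G * ?Xc) * (FQ * G)"
    using GD XD FQD by (simp add: mat_assoc)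
  also have "\<dots> = X * (transpose_mat Gd * FQ * G)"
    unfolding GXc using GD XD FQD by (simp add: mat_assoc)
  finally have GBG: "transpose_mat G * (?Xc * FQ) * G = X * (transpose_mat Gd * FQ * G)" .
  show "((G *\<^sub>v v1) @\<^sub>v (G *\<^sub>v v2)) \<bullet> (W *\<^sub>v ((G *\<^sub>v v1) @\<^sub>v (G *\<^sub>v v2))) =
      v1 \<bullet> ((P - 1\<^sub>m nx) *\<^sub>v v1) + 2 * (v1 \<bullet> (X * (transpose_mat Gd * FQ * G) *\<^sub>v v2)) + v2 \<bullet> (P *\<^sub>v v2)"
    unfolding W four_block_quad_form[OF A B D Gv]
      congruence_scalar_prod[OF G A v(1) v(1), symmetric] congruence_scalar_prod[OF G B v, symmetric]
      congruence_scalar_prod[OF G D v(2) v(2), symmetric] GBG GAG diag[OF PD] ..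
qed

text \<open>The left side is the trace of \<open>msqrt Q * P * msqrt Q\<close>. Cyclicity is carried
  out on entries by interchanging sums, with the symmetry of the root and of \<open>P\<close>
  aligning the indices.\<close>

lemma mtrace_sqrt:
  assumes Q: "Q \<in> carrier_mat n n" "pos_semidef Q" and P: "P \<in> carrier_mat n n" "sym_mat P"
  shows "(\<Sum>i<n. row (msqrt Q) i \<bullet> (P *\<^sub>v row (msqrt Q) i)) = mtrace (Q * P)"
proof -
  let ?s = "msqrt Q"
  note s = msqrt_props[OF Q]
  have s_sym: "?s $$ (i,j) = ?s $$ (j,i)" if "i < n" "j < n" for i j
  proof -
    have "transpose_mat ?s = ?s" using s(2) by (simp add: pos_semidef_def sym_mat_def)
    thus ?thesis using s(1) that by (metis carrier_matD index_transpose_mat(1))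
  qed
  have P_sym: "P $$ (i,j) = P $$ (j,i)" if "i < n" "j < n" for i j
    using P that by (metis carrier_matD index_transpose_mat(1) sym_mat_def)
  have "(\<Sum>i<n. row ?s i \<bullet> (P *\<^sub>v row ?s i)) = (\<Sum>i<n. \<Sum>j<n. \<Sum>k<n. ?s $$ (i,j) * (P $$ (j,k) * ?s $$ (i,k)))"
    using s(1) P by (intro sum.cong refl) (auto simp: scalar_prod_def atLeast0LessThan sum_distrib_left)
  also have "\<dots> = (\<Sum>j<n. \<Sum>i<n. \<Sum>k<n. ?s $$ (i,j) * (P $$ (j,k) * ?s $$ (i,k)))"
    by (rule sum.swap)
  also have "\<dots> = (\<Sum>j<n. \<Sum>k<n. \<Sum>i<n. ?s $$ (i,j) * (P $$ (j,k) * ?s $$ (i,k)))"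
    by (intro sum.cong refl sum.swap)
  also have "\<dots> = (\<Sum>j<n. \<Sum>k<n. Q $$ (j,k) * P $$ (k,j))"
  proof (intro sum.cong refl)
    fix j k assume "j \<in> {..<n}" "k \<in> {..<n}"
    hence jk: "j < n" "k < n" by auto
    have "Q $$ (j,k) = (\<Sum>i<n. ?s $$ (j,i) * ?s $$ (i,k))"
      using index_mult_mat_carrier[OF s(1) s(1) jk] s(3) by simp
    also have "\<dots> = (\<Sum>i<n. ?s $$ (i,j) * ?s $$ (i,k))"
      using jk by (intro sum.cong refl) (simp add: s_sym)
    finally show "(\<Sum>i<n. ?s $$ (i,j) * (P $$ (j,k) * ?s $$ (i,k))) = Q $$ (j,k) * P $$ (k,j)"
      using P_sym[OF jk] by (simp add: sum_distrib_left sum_distrib_right mult_ac)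
  qed
  also have "\<dots> = mtrace (Q * P)"
    unfolding mtrace_def using Q P index_mult_mat_carrier[OF Q(1) P(1)] by (intro sum.cong) auto
  finally show ?thesis .
qed

text \<open>The test vector pairs the unit vector with minus the row of \<open>C\<close>. This
  second component minimises the form, and as the off-diagonal block is \<open>C P\<close> no
  inverse of \<open>P\<close> enters; the minimum is a diagonal entry of the Schur
  complement.\<close>

lemma schur_diag_le:
  assumes S: "S \<in> carrier_mat m m" and C: "C \<in> carrier_mat m n" and P: "P \<in> carrier_mat n n"
    and pd: "pos_def (four_block_mat S (C * P) (transpose_mat (C * P)) P)" and i: "i < m"
  shows "row C i \<bullet> (P *\<^sub>v row C i) \<le> S $$ (i,i)"
proof -
  let ?e = "unit_vec m i :: real Matrix.vec" and ?r = "row C i" and ?b = "(-1) \<cdot>\<^sub>v row C i"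
  have r: "?r \<in> carrier_vec n" and b: "?b \<in> carrier_vec n" and e: "?e \<in> carrier_vec m"
    using C i by (auto intro!: carrier_vecI)
  have CP: "C * P \<in> carrier_mat m n" using C P by auto
  have Pr: "P *\<^sub>v ?r \<in> carrier_vec n" using mult_mat_vec_carrier[OF P r] .
  have Pb: "P *\<^sub>v ?b = (-1) \<cdot>\<^sub>v (P *\<^sub>v ?r)" by (rule mult_mat_vec[OF P r])
  have "0 \<le> (?e @\<^sub>v ?b) \<bullet> (four_block_mat S (C * P) (transpose_mat (C * P)) P *\<^sub>v (?e @\<^sub>v ?b))"
    by (rule pos_def_form_nonneg[OF pd, of "m + n"]) (use four_block_carrier_mat[OF S P] e b in auto)
  also have "\<dots> = ?e \<bullet> (S *\<^sub>v ?e) + 2 * (?e \<bullet> (C * P *\<^sub>v ?b)) + ?b \<bullet> (P *\<^sub>v ?b)"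
    by (rule four_block_quad_form[OF S CP P e b])
  also have "?e \<bullet> (S *\<^sub>v ?e) = S $$ (i,i)"
    using mult_mat_unit_vec[OF S i i] mult_mat_vec_carrier[OF S e] i by simp
  also have "?e \<bullet> (C * P *\<^sub>v ?b) = - (?r \<bullet> (P *\<^sub>v ?r))"
  proof -
    have "C * P *\<^sub>v ?b = C *\<^sub>v ((-1) \<cdot>\<^sub>v (P *\<^sub>v ?r))" using assoc_mult_mat_vec[OF C P b] Pb by simp
    moreover have "\<dots> \<in> carrier_vec m" using C Pr by auto
    ultimately have "?e \<bullet> (C * P *\<^sub>v ?b) = ?r \<bullet> ((-1) \<cdot>\<^sub>v (P *\<^sub>v ?r))"
      using C i by simp
    thus ?thesis using scalar_prod_smult_distrib[OF r Pr, of "-1"] by simp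
  qed
  also have "?b \<bullet> (P *\<^sub>v ?b) = ?r \<bullet> (P *\<^sub>v ?r)"
    unfolding Pb using r Pr by simp
  finally show ?thesis by simp
qed

theorem theorem5:
  fixes nx nu np Nd :: nat
    and PP :: "real Matrix.vec set"
    and A B :: "nat \<Rightarrow> real mat"
    and ud pd xd :: "nat \<Rightarrow> real Matrix.vec"
    and \<gamma> :: real and Q R P S Xi FQ FF Y0 Ybar :: "real mat"
  assumes PP: "sched_set np PP"
    and A_dim: "\<forall>i\<le>np. A i \<in> carrier_mat nx nx"
    and B_dim: "\<forall>i\<le>np. B i \<in> carrier_mat nx nu"
    and data_dim: "\<forall>k. 1 \<le> k \<and> k \<le> Nd \<longrightarrow>
         xd k \<in> carrier_vec nx \<and> ud k \<in> carrier_vec nu \<and> pd k \<in> PP"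
    and data_traj: "\<forall>k. 1 \<le> k \<and> k < Nd \<longrightarrow>
         xd (Suc k) = aff A np (pd k) *\<^sub>v xd k + aff B np (pd k) *\<^sub>v ud k"
    and rank: "full_row_rank (dataDp nx nu np Nd ud pd xd)"
    and gamma: "\<gamma> > 0"
    and Q: "Q \<in> carrier_mat nx nx" "pos_semidef Q"
    and R: "R \<in> carrier_mat nu nu" "pos_def R"
    and P_dim: "P \<in> carrier_mat nx nx" "sym_mat P"
    and S_dim: "S \<in> carrier_mat nu nu" "sym_mat S"
    and Xi_dim: "Xi \<in> carrier_mat (4 * np * nx) (4 * np * nx)" "sym_mat Xi"
    and FQ_dim: "FQ \<in> carrier_mat ((Nd - 1) * (1 + np)) (nx * (1 + np))"
    and FF_dim: "FF \<in> carrier_mat (Nd - 1) (nx * (1 + np + np * np))"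
    and FF_FQ: "\<forall>p\<in>PP.
          FF * vcat (1\<^sub>m nx) (vcat (kron (colv p) (1\<^sub>m nx)) (kron (colv p) (kron (colv p) (1\<^sub>m nx))))
        = transpose_mat (vcat (1\<^sub>m (Nd - 1)) (kron (colv p) (1\<^sub>m (Nd - 1)))) * FQ
          * vcat (1\<^sub>m nx) (kron (colv p) (1\<^sub>m nx))"
    and Y_dim: "Y0 \<in> carrier_mat nu nx" "Ybar \<in> carrier_mat nu (nx * np)"
    and lmi_data: "lhs_block nx nu np P Y0 Ybar = dataDp nx nu np Nd ud pd xd * FF"
    and lmi_S: "\<forall>p\<in>PP.
          pos_def (four_block_mat S (msqrt R * hcat Y0 Ybar * vcat (1\<^sub>m nx) (kron (colv p) (1\<^sub>m nx)))
                     (transpose_mat (msqrt R * hcat Y0 Ybar * vcat (1\<^sub>m nx) (kron (colv p) (1\<^sub>m nx)))) P)"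
    and lmi_P: "pos_def (P - 1\<^sub>m nx)"
    and lmi_tr: "mtrace (Q * P) + mtrace S < \<gamma>\<^sup>2"
    and lmi_fb: "full_block_lmi PP (Delta nx np)
                   (Wmat nx np P (dataXplus nx Nd xd) FQ)
                   (L11 nx np) (L12 nx np) (L21 nx np) (L22 nx np) Xi"
  shows
    "(let Kc = (\<lambda>i. if i = 0 then Y0 * minv P
                   else colblock (Ybar * minv (kron (1\<^sub>m np) P)) (i - 1) nx);
          K = (\<lambda>p. aff Kc np p);
          Acl = (\<lambda>p. aff A np p + aff B np p * K p);
          Cz = (\<lambda>p. vcat (msqrt Q) (msqrt R * K p))
      in lpv_stable nx PP Acl \<and>
         (\<forall>M :: 'w measure. prob_space M \<longrightarrow> h2g_sq M nx PP Acl Cz < ereal (\<gamma>\<^sup>2)))"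
proof -
  define Kc where "Kc = (\<lambda>i. if i = 0 then Y0 * minv P
    else colblock (Ybar * minv (kron (1\<^sub>m np) P)) (i - 1) nx)"
  define K where "K = aff Kc np"
  define Acl where "Acl = (\<lambda>p. aff A np p + aff B np p * K p)"
  define Cz where "Cz = (\<lambda>p. vcat (msqrt Q) (msqrt R * K p))"
  define N where "N = Nd - 1"
  let ?X = "dataXplus nx Nd xd" and ?D = "dataDp nx nu np Nd ud pd xd"
  let ?Ab = "hblocks A nx np nx" and ?Bb = "hblocks B nx np nu"
  have PP_dim: "dim_vec p = np" if "p \<in> PP" for p
    using PP that by (auto simp: sched_set_def)
  have PP_carrier: "p \<in> carrier_vec np" if "p \<in> PP" for p
    using PP_dim[OF that] by (auto intro: carrier_vecI)
  have P_form: "v \<bullet> ((P - 1\<^sub>m nx) *\<^sub>v v) = v \<bullet> (P *\<^sub>v v) - v \<bullet> v" if v: "v \<in> carrier_vec nx" for v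
  proof -
    have "(P - 1\<^sub>m nx) *\<^sub>v v = P *\<^sub>v v - v"
      using minus_mult_distrib_mat_vec[OF P_dim(1) one_carrier_mat v] v by simp
    thus ?thesis using scalar_prod_minus_distrib[OF v _ v] mult_mat_vec_carrier[OF P_dim(1) v] by simp
  qed
  \<comment> \<open>The bound \<open>P \<succeq> I\<close> serves twice: it makes \<open>P\<close>
    positive definite, hence invertible, and it starts both inductions on functionals.\<close>
  have P_ge: "v \<bullet> v \<le> v \<bullet> (P *\<^sub>v v)" if v: "v \<in> carrier_vec nx" for v
    using pos_def_form_nonneg[OF lmi_P minus_carrier_mat[OF one_carrier_mat] v] P_form[OF v] by simp
  have P_pd: "pos_def P"
    unfolding pos_def_def
  proof (intro conjI ballI impI)
    show "sym_mat P" by (rule P_dim)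
    fix v :: "real Matrix.vec" assume "v \<in> carrier_vec (dim_row P)" "v \<noteq> 0\<^sub>v (dim_row P)"
    hence v: "v \<in> carrier_vec nx" "v \<noteq> 0\<^sub>v nx" using P_dim by auto
    hence "v \<bullet> v > 0" using scalar_prod_self_nonneg[of v] scalar_prod_self_eq_0[OF v(1)] by linarith
    thus "v \<bullet> (P *\<^sub>v v) > 0" using P_ge[OF v(1)] by linarith
  qed
  have R_psd: "pos_semidef R"
    unfolding pos_semidef_def
  proof (intro conjI ballI)
    show "sym_mat R" using R by (simp add: pos_def_def)
    fix v :: "real Matrix.vec" assume "v \<in> carrier_vec (dim_row R)"
    thus "0 \<le> v \<bullet> (R *\<^sub>v v)" using R pos_def_form_nonneg[OF R(2,1)] by simp
  qed
  note sQ = msqrt_props(1)[OF Q] and sR = msqrt_props(1)[OF R(1) R_psd]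
  note K_carrier = gain_mult(1)[OF P_dim(1) P_pd Y_dim, folded Kc_def]
    and K_mult = gain_mult(2)[OF P_dim(1) P_pd Y_dim, folded Kc_def]
  have affA: "aff A np p = A 0 + ?Ab * kron (colv p) (1\<^sub>m nx)" if "p \<in> PP" for p
    by (rule aff_hblocks[OF A_dim PP_dim[OF that]])
  have affB: "aff B np p = B 0 + ?Bb * kron (colv p) (1\<^sub>m nu)" if "p \<in> PP" for p
    by (rule aff_hblocks[OF B_dim PP_dim[OF that]])
  have A0: "dim_row (A 0) = nx" "dim_col (A 0) = nx" and B0: "dim_row (B 0) = nx" "dim_col (B 0) = nu"
    using A_dim B_dim by auto
  have PD: "dim_row P = nx" "dim_col P = nx" using P_dim by auto
  have affA_carrier: "aff A np p \<in> carrier_mat nx nx" and affB_carrier: "aff B np p \<in> carrier_mat nx nu" if "p \<in> PP" for p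
    unfolding affA[OF that] affB[OF that] using A0 B0 PP_dim[OF that] by (auto intro!: carrier_matI)
  have Kp: "K p \<in> carrier_mat nu nx" if "p \<in> PP" for p
    unfolding K_def by (rule K_carrier[OF PP_dim[OF that]])
  have Acl_carrier: "Acl p \<in> carrier_mat nx nx" if "p \<in> PP" for p
    unfolding Acl_def using affA_carrier[OF that] affB_carrier[OF that] Kp[OF that]
    by (auto intro!: add_carrier_mat mult_carrier_mat)
  have Cz_carrier: "Cz p \<in> carrier_mat (nx + nu) nx" if "p \<in> PP" for p
    using sQ sR by (auto simp: Cz_def intro!: carrier_matI)
  have X: "?X = hcat (A 0) (hcat ?Ab (hcat (B 0) ?Bb)) * ?D"
    by (rule dataXplus_eq[OF A_dim B_dim]) (use data_dim data_traj PP_carrier in auto)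
  have XD: "dim_row ?X = nx" "dim_col ?X = N" by (auto simp: dataXplus_def N_def)
  have DD: "dim_row ?D = nx + (np * nx + (nu + np * nu))" "dim_col ?D = N"
    by (auto simp: dataDp_def dataX_def dataXp_def dataU_def dataUp_def N_def)
  \<comment> \<open>The left side is the off-diagonal block left by the congruence. Trading
    \<open>FQ\<close> for \<open>FF\<close> brings \<open>?D * FF\<close> into play, which the data
    equation knows; the true coefficients enter through \<open>?X\<close> and recombine into the
    closed loop.\<close>
  have closed_loop: "?X * (transpose_mat (vcat (1\<^sub>m N) (kron (colv p) (1\<^sub>m N))) * FQ * vcat (1\<^sub>m nx) (kron (colv p) (1\<^sub>m nx)))
      = Acl p * P" if p: "p \<in> PP" for p
  proof -
    let ?E = "kron (colv p) (1\<^sub>m nx)"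
    let ?V = "vcat (1\<^sub>m nx) (vcat ?E (kron (colv p) ?E))"
    let ?Y = "Y0 + Ybar * ?E"
    note pd = PP_dim[OF p]
    have FFD: "dim_row FF = N" "dim_col FF = nx + (np * nx + np * (np * nx))"
      using FF_dim by (auto simp: N_def algebra_simps)
    have YD: "dim_row ?Y = nu" "dim_col ?Y = nx" using Y_dim pd by auto
    have KP: "K p * P = ?Y" unfolding K_def by (rule K_mult[OF pd])
    have KD: "dim_row (K p) = nu" "dim_col (K p) = nx" using Kp[OF p] by auto
    have "?X * (transpose_mat (vcat (1\<^sub>m N) (kron (colv p) (1\<^sub>m N))) * FQ * vcat (1\<^sub>m nx) ?E) = ?X * (FF * ?V)"
      using FF_FQ p by (simp add: N_def)
    also have "\<dots> = hcat (A 0) (hcat ?Ab (hcat (B 0) ?Bb)) * (?D * FF * ?V)"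
      unfolding X using A0 B0 DD FFD pd by (simp add: mat_assoc)
    also have "?D * FF * ?V = vcat P (vcat (kron (colv p) P) (vcat ?Y (kron (colv p) ?Y)))"
      unfolding lmi_data[symmetric] by (rule lhs_block_mult[OF P_dim(1) Y_dim pd])
    also have "hcat (A 0) (hcat ?Ab (hcat (B 0) ?Bb)) * \<dots> =
        A 0 * P + (?Ab * kron (colv p) P + (B 0 * ?Y + ?Bb * kron (colv p) ?Y))"
      using A0 B0 PD YD pd by (simp add: hcat_mult_vcat del: index_add_mat)
    also have "\<dots> = A 0 * P + (?Ab * (?E * P) + (B 0 * ?Y + ?Bb * (kron (colv p) (1\<^sub>m nu) * ?Y)))"
      using PD YD by (simp only: kron_colv_one_mult)
    also have "\<dots> = (A 0 * P + ?Ab * ?E * P) + (B 0 * ?Y + ?Bb * kron (colv p) (1\<^sub>m nu) * ?Y)"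
    proof -
      have "?Ab * (?E * P) = ?Ab * ?E * P" "?Bb * (kron (colv p) (1\<^sub>m nu) * ?Y) = ?Bb * kron (colv p) (1\<^sub>m nu) * ?Y"
        using PD YD pd by (subst mat_assoc; simp)+
      thus ?thesis using A0 B0 PD YD pd by (subst assoc_add_mat[of _ nx nx]) (auto intro!: carrier_matI)
    qed
    also have "A 0 * P + ?Ab * ?E * P = aff A np p * P"
      unfolding affA[OF p]
      by (rule add_mult_distrib_mat[of _ nx nx _ _ nx, symmetric]) (use A0 PD pd in \<open>auto intro!: carrier_matI\<close>)
    also have "B 0 * ?Y + ?Bb * kron (colv p) (1\<^sub>m nu) * ?Y = aff B np p * ?Y"
      unfolding affB[OF p]
      by (rule add_mult_distrib_mat[of _ nx nu _ _ nx, symmetric]) (use B0 YD pd in \<open>auto intro!: carrier_matI\<close>)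
    also have "aff B np p * ?Y = aff B np p * K p * P"
      unfolding KP[symmetric] using affB_carrier[OF p] KD PD by (subst mat_assoc) auto
    also have "aff A np p * P + aff B np p * K p * P = Acl p * P"
      unfolding Acl_def
      by (rule add_mult_distrib_mat[of _ nx nx _ _ nx, symmetric])
        (use affA_carrier[OF p] affB_carrier[OF p] Kp[OF p] P_dim in \<open>auto intro!: mult_carrier_mat\<close>)
    finally show ?thesis .
  qed
  have lyap: "(transpose_mat (Acl p) *\<^sub>v v) \<bullet> (P *\<^sub>v (transpose_mat (Acl p) *\<^sub>v v)) + v \<bullet> v \<le> v \<bullet> (P *\<^sub>v v)"
    if p: "p \<in> PP" and v: "v \<in> carrier_vec nx" for p v
  proof -
    let ?u = "transpose_mat (Acl p) *\<^sub>v v" and ?b = "(-1) \<cdot>\<^sub>v (transpose_mat (Acl p) *\<^sub>v v)"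
    have u: "?u \<in> carrier_vec nx" using Acl_carrier[OF p] v by auto
    hence b: "?b \<in> carrier_vec nx" by simp
    have vb: "v @\<^sub>v ?b \<in> carrier_vec (2 * nx)" 
      by (rule carrier_vecI) (use carrier_vecD[OF v] carrier_vecD[OF b] in simp)
    have Pu: "P *\<^sub>v ?u \<in> carrier_vec nx" using mult_mat_vec_carrier[OF P_dim(1) u] .
    have Pb: "P *\<^sub>v ?b = (-1) \<cdot>\<^sub>v (P *\<^sub>v ?u)" by (rule mult_mat_vec[OF P_dim(1) u])
    have X_carrier: "?X \<in> carrier_mat nx N" using XD by auto
    have FQ: "FQ \<in> carrier_mat (N * (1 + np)) (nx * (1 + np))" using FQ_dim by (simp add: N_def)
    note Wm = Wmat_congruence[OF P_dim(1) X_carrier FQ PP_dim[OF p] v b]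
    \<comment> \<open>Closing the scheduling channel, applying the congruence and inserting the
      closed loop turn the multiplier condition into a plain form in \<open>v\<close> and
      \<open>?b\<close>.\<close>
    have "0 \<le> v \<bullet> ((P - 1\<^sub>m nx) *\<^sub>v v) + 2 * (v \<bullet> (Acl p * P *\<^sub>v ?b)) + ?b \<bullet> (P *\<^sub>v ?b)"
      using full_block_lmi_nonneg[OF lmi_fb p PP_dim[OF p] Xi_dim(1) Wm(1) vb]
      unfolding L_mult_append[OF PP_dim[OF p] v b] Wm(2) closed_loop[OF p] .
    also have "v \<bullet> (Acl p * P *\<^sub>v ?b) = - (?u \<bullet> (P *\<^sub>v ?u))"
    proof -
      have "v \<bullet> (Acl p * P *\<^sub>v ?b) = v \<bullet> (Acl p *\<^sub>v ((-1) \<cdot>\<^sub>v (P *\<^sub>v ?u)))"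
        using assoc_mult_mat_vec[OF Acl_carrier[OF p] P_dim(1) b] Pb by simp
      also have "\<dots> = ?u \<bullet> ((-1) \<cdot>\<^sub>v (P *\<^sub>v ?u))"
        by (rule adjoint_scalar_prod[OF Acl_carrier[OF p] v]) (use Pu in simp)
      also have "\<dots> = - (?u \<bullet> (P *\<^sub>v ?u))"
        using scalar_prod_smult_distrib[OF u Pu, of "-1"] by simp
      finally show ?thesis .
    qed
    also have "?b \<bullet> (P *\<^sub>v ?b) = ?u \<bullet> (P *\<^sub>v ?u)"
      unfolding Pb using u Pu by simp
    finally show ?thesis using P_form[OF v] by simp
  qed
  have out: "(\<Sum>i<nx + nu. row (Cz p) i \<bullet> (P *\<^sub>v row (Cz p) i)) \<le> mtrace (Q * P) + mtrace S" if p: "p \<in> PP" for p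
  proof -
    let ?C = "msqrt R * K p" and ?E = "kron (colv p) (1\<^sub>m nx)"
    note pd = PP_dim[OF p]
    have C: "?C \<in> carrier_mat nu nx" using sR Kp[OF p] by auto
    \<comment> \<open>Replacing \<open>Y(p)\<close> by \<open>K(p) P\<close> gives the block the
      shape \<open>C P\<close> on which the Schur bound relies.\<close>
    have "msqrt R * hcat Y0 Ybar * vcat (1\<^sub>m nx) ?E = msqrt R * (hcat Y0 Ybar * vcat (1\<^sub>m nx) ?E)"
      using sR Y_dim pd by (intro mat_assoc) auto
    also have "hcat Y0 Ybar * vcat (1\<^sub>m nx) ?E = K p * P"
      unfolding K_def K_mult[OF pd] using Y_dim pd by (intro hcat_affine) auto
    also have "msqrt R * (K p * P) = ?C * P"
      using sR Kp[OF p] PD by (intro mat_assoc[symmetric]) auto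
    finally have eq: "msqrt R * hcat Y0 Ybar * vcat (1\<^sub>m nx) ?E = ?C * P" .
    have pdS: "pos_def (four_block_mat S (?C * P) (transpose_mat (?C * P)) P)"
      using lmi_S[rule_format, OF p] unfolding eq .
    have dims: "dim_row (msqrt Q) = nx" "dim_col (msqrt Q) = nx" "dim_row ?C = nu" "dim_col ?C = nx"
      using sQ C by auto
    have "row (Cz p) i = row (msqrt Q) i" if "i < nx" for i
      unfolding Cz_def using that dims by (subst row_vcat) (simp_all only: if_True trans_less_add1)
    moreover have "row (Cz p) (nx + i) = row ?C i" if "i < nu" for i
      unfolding Cz_def using that dims by (subst row_vcat) (simp_all only:, simp_all)
    ultimately have "(\<Sum>i<nx + nu. row (Cz p) i \<bullet> (P *\<^sub>v row (Cz p) i)) =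
        (\<Sum>i<nx. row (msqrt Q) i \<bullet> (P *\<^sub>v row (msqrt Q) i)) + (\<Sum>i<nu. row ?C i \<bullet> (P *\<^sub>v row ?C i))"
      unfolding sum_lessThan_add by simp
    also have "(\<Sum>i<nx. row (msqrt Q) i \<bullet> (P *\<^sub>v row (msqrt Q) i)) = mtrace (Q * P)"
      by (rule mtrace_sqrt[OF Q P_dim])
    also have "(\<Sum>i<nu. row ?C i \<bullet> (P *\<^sub>v row ?C i)) \<le> (\<Sum>i<nu. S $$ (i,i))"
      by (intro sum_mono schur_diag_le[OF S_dim(1) C P_dim(1) pdS]) simp
    also have "(\<Sum>i<nu. S $$ (i,i)) = mtrace S" using S_dim by (simp add: mtrace_def)
    finally show ?thesis by simp
  qed
  have "lpv_stable nx PP Acl"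
    unfolding lpv_stable_def
  proof (intro allI impI)
    fix ps :: "nat \<Rightarrow> real Matrix.vec" assume "\<forall>k. ps k \<in> PP"
    hence ps: "ps k \<in> PP" for k by blast
    \<comment> \<open>The same \<open>P\<close> works at every point of \<open>PP\<close>, so
      arbitrarily fast variation of the scheduling is covered.\<close>
    show "asym_stable nx (\<lambda>k. Acl (ps k))"
      by (rule asym_stable_if_lyapunov[OF Acl_carrier[OF ps] P_dim(1) lyap[OF ps] P_ge])
  qed
  moreover have "h2g_sq M nx PP Acl Cz < ereal (\<gamma>\<^sup>2)" for M :: "'w measure"
  proof -
    \<comment> \<open>The bound by the two traces is the same for all schedules and noises. A
      supremum alone would weaken a strict inequality; here strictness is taken from the trace
      condition afterwards.\<close>
    have "h2g_sq M nx PP Acl Cz \<le> ereal (mtrace (Q * P) + mtrace S)"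
      by (rule h2g_sq_le[OF Acl_carrier Cz_carrier lyap P_ge out])
    also have "\<dots> < ereal (\<gamma>\<^sup>2)" using lmi_tr by simp
    finally show ?thesis .
  qed
  ultimately show ?thesis
    unfolding Let_def Acl_def Cz_def K_def Kc_def by blast
qed

end
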